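(* Let $\alpha>0$. In the linear regression model $Y=\beta^tX+U$, the influence functions of the functionals $T$ and $S$ associated to the $\min\mathfrak{R}_\alpha$-estimators of $\beta$ and $\sigma$ are, for $(x_0,y_0)\in\mathbb{R}^p\times\mathbb{R}$, $$\mathrm{IF}(x_0,y_0;T,P_\xi)=\sigma(\alpha+1)^{3/2}\exp\left(-\frac\alpha2\left(\frac{y_0-\beta^tx_0}{\sigma}\right)^2\right)\left(\frac{y_0-\beta^tx_0}{\sigma}\right)V_X^{-1}x_0,$$ $$\mathrm{IF}(x_0,y_0;S,P_\xi)=\frac{\sigma(\alpha+1)^{5/2}}{2}\exp\left(-\frac\alpha2\left(\frac{y_0-\beta^tx_0}{\sigma}\right)^2\right)\left[\left(\frac{y_0-\beta^tx_0}{\sigma}\right)^2-\frac1{\alpha+1}\right],$$ where $P_\xi$ is the probability distribution of $Z=(X,Y)$.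
   Context: Model: $(X,Y)$ is a random vector in $\mathbb{R}^p\times\mathbb{R}$ with $Y=\beta^tX+U$, where $\beta\in\mathbb{R}^p$, $U$ is normal with mean $0$ and standard deviation $\sigma>0$ and is independent of $X$; the distribution of $X$ is not concentrated on any subspace, i.e. $P(a^tX=0)<1$ for all $a\ne0$; $V_X=E[XX^t]$ (assumed finite). $\xi=(\beta,\sigma)$ and $P_\xi$ is the distribution of $Z=(X,Y)$. Vectors are columns; superscript $t$ is transpose. The $\min\mathfrak{R}_\alpha$-estimators $(\widehat\beta,\widehat\sigma)$ based on i.i.d. observations $(X_i,Y_i)$, $i=1,\dots,n$, are defined by $$\arg\sup_{\beta,\sigma}\sum_{i=1}^n\sigma^{-\alpha/(\alpha+1)}\exp\left(-\frac\alpha2\left(\frac{Y_i-\beta^tX_i}{\sigma}\right)^2\right),$$ and are solutions of $\sum_{i=1}^n\phi\left(\frac{Y_i-\beta^tX_i}{\sigma}\right)X_i=0$, $\sum_{i=1}^n\chi\left(\frac{Y_i-\beta^tX_i}{\sigma}\right)=0$, with $$\phi(u)=u\exp\left(-\frac\alpha2u^2\right),\qquad\chi(u)=\left[u^2-\frac1{\alpha+1}\right]\exp\left(-\frac\alpha2u^2\right).$$ The corresponding statistical functionals $T$ (for $\beta$) and $S$ (for $\sigma$) are defined, for a probability measure $P$ on $\mathbb{R}^p\times\mathbb{R}$, through the solutions $(T(P),S(P))$ of the system $$\int\phi\left(\frac{y-T(P)^tx}{S(P)}\right)x\,\mathrm{d}P(x,y)=0,\qquad\int\chi\left(\frac{y-T(P)^tx}{S(P)}\right)\mathrm{d}P(x,y)=0,$$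 with $T(P_\xi)=\beta$, $S(P_\xi)=\sigma$. Influence function of a functional $F$ at $P_\xi$: $\mathrm{IF}(x_0,y_0;F,P_\xi)=\lim_{\varepsilon\to0}\frac{F(\widetilde P_{\varepsilon,x_0,y_0})-F(P_\xi)}{\varepsilon}$, where $\widetilde P_{\varepsilon,x_0,y_0}=(1-\varepsilon)P_\xi+\varepsilon\delta_{(x_0,y_0)}$.
   Formalization: The estimating equations can have several solutions at contaminated distributions, so T and S are additionally required to be continuous at P_ξ along point contaminations (the branch through (β,σ)); existence of such T, S is proved, and the limit is taken as ε→0+. *)

theory Defs
  imports "HOL-Probability.Probability"
begin

definition minR_phi :: "real \<Rightarrow> real \<Rightarrow> real" where
  "minR_phi \<alpha> u = u * exp (- (\<alpha> / 2) * u\<^sup>2)"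

definition minR_chi :: "real \<Rightarrow> real \<Rightarrow> real" where
  "minR_chi \<alpha> u = (u\<^sup>2 - 1 / (\<alpha> + 1)) * exp (- (\<alpha> / 2) * u\<^sup>2)"

text \<open>
  The estimating equations at a measure on pairs \<open>(x, y)\<close>. Using \<open>has_bochner_integral\<close>
  rather than an equation between integrals excludes solutions that hold only because the
  integral of a non-integrable function is 0 by convention.
\<close>

definition minR_solution ::
  "real \<Rightarrow> ((real ^ 'p::finite) \<times> real) measure \<Rightarrow> real ^ 'p \<Rightarrow> real \<Rightarrow> bool" where
  "minR_solution \<alpha> P b s \<longleftrightarrow> s > 0 \<and>
     has_bochner_integral P (\<lambda>(x, y). minR_phi \<alpha> ((y - b \<bullet> x) / s) *\<^sub>R x) 0 \<and>
     has_bochner_integral P (\<lambda>(x, y). minR_chi \<alpha> ((y - b \<bullet> x) / s)) 0"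

text \<open>The mixture \<open>(1 - \<epsilon>) P + \<epsilon> \<delta>\<^sub>z\<close>; meaningful for \<open>0 \<le> \<epsilon> \<le> 1\<close> only.\<close>

definition contaminated :: "'z measure \<Rightarrow> 'z \<Rightarrow> real \<Rightarrow> 'z measure" where
  "contaminated P z \<epsilon> = measure_of (space P) (sets P)
     (\<lambda>A. ennreal (1 - \<epsilon>) * emeasure P A + ennreal \<epsilon> * emeasure (return P z) A)"

text \<open>The limit is one-sided because the mixture is a probability measure only for
  \<open>\<epsilon> \<ge> 0\<close>.\<close>

definition has_influence_function ::
  "('z measure \<Rightarrow> 'b::real_normed_vector) \<Rightarrow> 'z measure \<Rightarrow> 'z \<Rightarrow> 'b \<Rightarrow> bool" where
  "has_influence_function F P z v \<longleftrightarrow>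
     ((\<lambda>\<epsilon>. (F (contaminated P z \<epsilon>) - F P) /\<^sub>R \<epsilon>) \<longlongrightarrow> v) (at_right 0)"

text \<open>
  Functionals \<open>(T, S)\<close> defined through the solutions of the estimating equations, with value
  \<open>(b, s)\<close> at the model distribution \<open>P\<^sub>0\<close>. The equations are not solvable at every
  probability measure (e.g. not at a point mass with \<open>x \<noteq> 0\<close>), so a solution is required
  wherever there is one. Nor are solutions unique: at a contaminated measure there can be, besides
  the solution near \<open>(b, s)\<close>, one that nearly fits the contaminating point exactly, with scale
  tending to 0 with \<open>\<epsilon>\<close>. The last clause says that \<open>(T, S)\<close> follows the
  branch issuing from \<open>(b, s)\<close>; it asks for continuity along contaminations, not for
  differentiability.
\<close>

definition minR_functionals ::
  "real \<Rightarrow> ((real ^ 'p::finite) \<times> real) measure \<Rightarrow> real ^ 'p \<Rightarrow> real \<Rightarrow>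
   (((real ^ 'p) \<times> real) measure \<Rightarrow> real ^ 'p) \<Rightarrow>
   (((real ^ 'p) \<times> real) measure \<Rightarrow> real) \<Rightarrow> bool" where
  "minR_functionals \<alpha> P\<^sub>0 b s T S \<longleftrightarrow>
     (\<forall>P. prob_space P \<and> sets P = sets borel \<and> (\<exists>b' s'. minR_solution \<alpha> P b' s')
        \<longrightarrow> minR_solution \<alpha> P (T P) (S P)) \<and>
     minR_solution \<alpha> P\<^sub>0 (T P\<^sub>0) (S P\<^sub>0) \<and> T P\<^sub>0 = b \<and> S P\<^sub>0 = s \<and>
     (\<forall>z. ((\<lambda>\<epsilon>. T (contaminated P\<^sub>0 z \<epsilon>)) \<longlongrightarrow> T P\<^sub>0) (at_right 0) \<and>
          ((\<lambda>\<epsilon>. S (contaminated P\<^sub>0 z \<epsilon>)) \<longlongrightarrow> S P\<^sub>0) (at_right 0))"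

definition second_moment_matrix :: "'a measure \<Rightarrow> ('a \<Rightarrow> real ^ 'p::finite) \<Rightarrow> real ^ 'p ^ 'p" where
  "second_moment_matrix M X = (\<chi> i j. \<integral>\<omega>. X \<omega> $ i * X \<omega> $ j \<partial>M)"

end

theory Submission
  imports Defs
begin

text \<open>
  Combine the two estimating functions into one score with values in the parameter space, evaluated
  at \<open>\<theta> = (b, s)\<close> and an observation \<open>z\<close>, and let \<open>F \<theta>\<close> be its mean under the model
  and \<open>G \<theta>\<close> its value at the contaminating point \<open>z\<^sub>0\<close>. The estimating equations at the contaminated
  measure read \<open>(1 - \<epsilon>) F \<theta> + \<epsilon> G \<theta> = 0\<close>. At the model \<open>F\<close> vanishes, and if its derivative \<open>A\<close> there is
  invertible, first order expansion of the equation along a branch \<open>\<theta>(\<epsilon>)\<close> of solutions issuing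
  from \<open>\<theta>\<^sub>0 = (\<beta>, \<sigma>)\<close> gives \<open>- A\<^sup>-\<^sup>1 (G \<theta>\<^sub>0)\<close> for the derivative of the branch at \<open>\<epsilon> = 0\<close>. This is the
  pair of influence functions.

  Two facts about perturbed zeros make this rigorous. A branch that is merely continuous at
  \<open>\<epsilon> = 0\<close> is differentiable there (\<open>perturbed_zero_derivative\<close>). Solutions near
  \<open>\<theta>\<^sub>0\<close> exist for all small \<open>\<epsilon>\<close> (\<open>perturbed_zero_exists_near\<close>, from Brouwer's fixed point
  theorem); hence functionals defined through the solutions do return solutions, and selecting a
  solution nearest to \<open>\<theta>\<^sub>0\<close> yields such functionals (\<open>functionals_exist\<close>). Besides continuity near
  \<open>\<theta>\<^sub>0\<close> both facts need differentiability of \<open>F\<close> at \<open>\<theta>\<^sub>0\<close> only, which follows by dominated convergence from a Lipschitz bound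
  on the score that is quadratic in the observation (\<open>minR_score_lipschitz\<close>).

  The derivative is explicit (\<open>mean_score_has_derivative\<close>). Regressor and error being
  independent, its blocks are products of moments of the regressor with expectations of
  functions of the error. For the two mixed blocks these functions are odd, so \<open>A\<close> is block
  diagonal. The slope block is a multiple of the second moment matrix, which is positive definite because the regressor
  is not concentrated on a hyperplane through the origin. The scalar factors are normal moments weighted by
  \<open>exp (- (\<alpha> / 2) u\<^sup>2)\<close>, that is, moments of a normal distribution with variance divided by \<open>\<alpha> + 1\<close>
  (\<open>normal_density_tilt\<close>).
\<close>

section \<open>Zeros of perturbed maps\<close>

text \<open>
  The zeros sought are the fixed points of the Newton map
  \<open>\<theta> - B ((1 - \<epsilon>) F \<theta> + \<epsilon> G \<theta>)\<close>. On a ball of small radius \<open>t\<close> the error of the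
  linearization of \<open>F\<close> displaces the image from \<open>\<theta>\<^sub>0\<close> by at most \<open>t / 2\<close>, and the perturbation,
  being of order \<open>\<epsilon>\<close>, by at most another \<open>t / 2\<close>, so that the ball is mapped into itself. Brouwer's
  theorem then replaces the contraction argument of the implicit function theorem; the price for
  asking differentiability at \<open>\<theta>\<^sub>0\<close> alone is that the zero need not be unique.
\<close>
lemma perturbed_zero_exists_near:
  fixes F G :: "'e::euclidean_space \<Rightarrow> 'e"
  assumes F0: "F \<theta>\<^sub>0 = 0" and der: "(F has_derivative A) (at \<theta>\<^sub>0)"
    and B: "linear B" and BA: "\<And>h. B (A h) = h" and AB: "\<And>w. A (B w) = w"
    and \<rho>: "\<rho> > 0" and contF: "continuous_on (cball \<theta>\<^sub>0 \<rho>) F" and contG: "continuous_on (cball \<theta>\<^sub>0 \<rho>) G"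
    and r: "r > 0"
  shows "\<forall>\<^sub>F \<epsilon> in at_right 0. \<exists>\<theta>\<in>cball \<theta>\<^sub>0 r \<inter> cball \<theta>\<^sub>0 \<rho>. (1 - \<epsilon>) *\<^sub>R F \<theta> + \<epsilon> *\<^sub>R G \<theta> = 0"
proof -
  interpret B: bounded_linear B using B by (simp add: linear_conv_bounded_linear)
  have "((\<lambda>\<theta>. B (F \<theta>)) has_derivative (\<lambda>h. h)) (at \<theta>\<^sub>0)"
    using B.has_derivative[OF der] by (simp add: BA)
  then obtain d where d: "d > 0"
    and near: "\<And>\<theta>. norm (\<theta> - \<theta>\<^sub>0) < d \<Longrightarrow> norm (B (F \<theta>) - (\<theta> - \<theta>\<^sub>0)) \<le> 1 / 2 * norm (\<theta> - \<theta>\<^sub>0)"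
    unfolding has_derivative_at_alt by (auto simp: F0 B.zero dest!: spec[of _ "1 / 2"])
  \<comment> \<open>Half of \<open>d\<close>, as the closed ball must lie in the open ball of radius \<open>d\<close>.\<close>
  define t where "t = min (min r \<rho>) (d / 2)"
  have t: "t > 0" "t \<le> r" "t \<le> \<rho>" "t < d" using r \<rho> d by (auto simp: t_def)
  have contF': "continuous_on (cball \<theta>\<^sub>0 t) F" and contG': "continuous_on (cball \<theta>\<^sub>0 t) G"
    using contF contG t by (auto elim!: continuous_on_subset)
  have "continuous_on (cball \<theta>\<^sub>0 t) (\<lambda>\<theta>. B (G \<theta> - F \<theta>))"
    by (intro B.continuous_on continuous_on_diff contF' contG')
  then have "bounded ((\<lambda>\<theta>. B (G \<theta> - F \<theta>)) ` cball \<theta>\<^sub>0 t)"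
    by (intro compact_imp_bounded compact_continuous_image) auto
  then obtain C where C: "C > 0" "\<And>\<theta>. \<theta> \<in> cball \<theta>\<^sub>0 t \<Longrightarrow> norm (B (G \<theta> - F \<theta>)) \<le> C"
    unfolding bounded_pos by auto
  have "\<exists>\<theta>\<in>cball \<theta>\<^sub>0 r \<inter> cball \<theta>\<^sub>0 \<rho>. (1 - \<epsilon>) *\<^sub>R F \<theta> + \<epsilon> *\<^sub>R G \<theta> = 0"
    if \<epsilon>: "0 < \<epsilon>" "\<epsilon> < t / (2 * C)" for \<epsilon>
  proof -
    define H where "H \<theta> = \<theta> - B ((1 - \<epsilon>) *\<^sub>R F \<theta> + \<epsilon> *\<^sub>R G \<theta>)" for \<theta>
    \<comment> \<open>The error of the linearization and the perturbation, separated.\<close>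
    have Heq: "H \<theta> = \<theta>\<^sub>0 - ((B (F \<theta>) - (\<theta> - \<theta>\<^sub>0)) + \<epsilon> *\<^sub>R B (G \<theta> - F \<theta>))" for \<theta>
      by (simp add: H_def B.add B.diff B.scaleR algebra_simps)
    have "H \<in> cball \<theta>\<^sub>0 t \<rightarrow> cball \<theta>\<^sub>0 t"
    proof
      fix \<theta> assume \<theta>: "\<theta> \<in> cball \<theta>\<^sub>0 t"
      then have n: "norm (\<theta> - \<theta>\<^sub>0) \<le> t" by (simp add: dist_norm norm_minus_commute)
      have "norm (B (F \<theta>) - (\<theta> - \<theta>\<^sub>0)) \<le> t / 2"
        using near[of \<theta>] n t by simp
      moreover have "norm (\<epsilon> *\<^sub>R B (G \<theta> - F \<theta>)) \<le> t / 2"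
      proof -
        have "\<epsilon> * norm (B (G \<theta> - F \<theta>)) \<le> t / (2 * C) * C"
          using \<epsilon> C(2)[OF \<theta>] C(1) by (intro mult_mono) auto
        then show ?thesis using \<epsilon> C(1) by simp
      qed
      ultimately have "norm ((B (F \<theta>) - (\<theta> - \<theta>\<^sub>0)) + \<epsilon> *\<^sub>R B (G \<theta> - F \<theta>)) \<le> t"
        by (intro norm_triangle_le) simp
      then show "H \<theta> \<in> cball \<theta>\<^sub>0 t"
        unfolding Heq mem_cball dist_norm by (simp only: diff_diff_eq2 add_diff_cancel_left')
    qed
    moreover have "continuous_on (cball \<theta>\<^sub>0 t) H"
      unfolding H_def by (intro continuous_intros B.continuous_on contF' contG')
    ultimately obtain \<theta> where \<theta>: "\<theta> \<in> cball \<theta>\<^sub>0 t" "H \<theta> = \<theta>"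
      using brouwer[of "cball \<theta>\<^sub>0 t" H] t(1) by auto
    then have "B ((1 - \<epsilon>) *\<^sub>R F \<theta> + \<epsilon> *\<^sub>R G \<theta>) = 0" by (simp add: H_def)
    then have "(1 - \<epsilon>) *\<^sub>R F \<theta> + \<epsilon> *\<^sub>R G \<theta> = 0"
      by (metis AB B.zero)
    then show ?thesis using \<theta>(1) t by auto
  qed
  then show ?thesis
    unfolding eventually_at_right_field using t(1) C(1)
    by (intro exI[of _ "t / (2 * C)"]) auto
qed

text \<open>
  Applying \<open>B\<close> to the equation and dividing by \<open>\<epsilon>\<close> shows that the quotient \<open>q\<close> in question is
  within \<open>o(1) |q|\<close> of a quantity \<open>c\<close> that converges to \<open>- B (G \<theta>\<^sub>0)\<close>. This first bounds \<open>q\<close>, and then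
  makes the error \<open>o(1)\<close>. Any family of zeros that converges to \<open>\<theta>\<^sub>0\<close> is covered, however it was
  selected.
\<close>
lemma perturbed_zero_derivative:
  fixes F G :: "'e::euclidean_space \<Rightarrow> 'e" and \<theta> :: "real \<Rightarrow> 'e"
  assumes F0: "F \<theta>\<^sub>0 = 0" and der: "(F has_derivative A) (at \<theta>\<^sub>0)"
    and B: "linear B" and BA: "\<And>h. B (A h) = h"
    and contG: "isCont G \<theta>\<^sub>0"
    and lim: "(\<theta> \<longlongrightarrow> \<theta>\<^sub>0) (at_right 0)"
    and zero: "\<forall>\<^sub>F \<epsilon> in at_right 0. (1 - \<epsilon>) *\<^sub>R F (\<theta> \<epsilon>) + \<epsilon> *\<^sub>R G (\<theta> \<epsilon>) = 0"
  shows "((\<lambda>\<epsilon>. (\<theta> \<epsilon> - \<theta>\<^sub>0) /\<^sub>R \<epsilon>) \<longlongrightarrow> - B (G \<theta>\<^sub>0)) (at_right 0)"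
proof -
  interpret B: bounded_linear B using B by (simp add: linear_conv_bounded_linear)
  have derB: "((\<lambda>\<theta>. B (F \<theta>)) has_derivative (\<lambda>h. h)) (at \<theta>\<^sub>0)"
    using B.has_derivative[OF der] by (simp add: BA)
  define q where "q \<epsilon> = (\<theta> \<epsilon> - \<theta>\<^sub>0) /\<^sub>R \<epsilon>" for \<epsilon>
  \<comment> \<open>The value \<open>q\<close> would have if \<open>F\<close> were linear.\<close>
  define c where "c \<epsilon> = - ((1 / (1 - \<epsilon>)) *\<^sub>R B (G (\<theta> \<epsilon>)))" for \<epsilon>
  have G_lim: "((\<lambda>\<epsilon>. G (\<theta> \<epsilon>)) \<longlongrightarrow> G \<theta>\<^sub>0) (at_right 0)"
    using contG lim by (rule isCont_tendsto_compose)
  have "(c \<longlongrightarrow> - ((1 / (1 - 0)) *\<^sub>R B (G \<theta>\<^sub>0))) (at_right 0)"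
    unfolding c_def by (intro tendsto_intros B.tendsto G_lim) auto
  then have c_lim: "(c \<longlongrightarrow> - B (G \<theta>\<^sub>0)) (at_right 0)" by simp
  have pos: "\<forall>\<^sub>F \<epsilon> in at_right (0::real). 0 < \<epsilon> \<and> \<epsilon> < 1"
    unfolding eventually_at_right_field by (intro exI[of _ 1]) auto
  have close: "\<forall>\<^sub>F \<epsilon> in at_right 0. norm (c \<epsilon> - q \<epsilon>) \<le> e * norm (q \<epsilon>)" if e: "e > 0" for e
  proof -
    obtain d where d: "d > 0"
      and near: "\<And>y. norm (y - \<theta>\<^sub>0) < d \<Longrightarrow> norm (B (F y) - (y - \<theta>\<^sub>0)) \<le> e * norm (y - \<theta>\<^sub>0)"
      using derB e unfolding has_derivative_at_alt by (auto simp: F0 B.zero dest!: spec[of _ e])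
    have "\<forall>\<^sub>F \<epsilon> in at_right 0. dist (\<theta> \<epsilon>) \<theta>\<^sub>0 < d" using lim d by (rule tendstoD)
    then show ?thesis using pos zero
    proof eventually_elim
      case (elim \<epsilon>)
      have "B ((1 - \<epsilon>) *\<^sub>R F (\<theta> \<epsilon>) + \<epsilon> *\<^sub>R G (\<theta> \<epsilon>)) = 0" using elim(3) by (simp add: B.zero)
      then have "(1 - \<epsilon>) *\<^sub>R B (F (\<theta> \<epsilon>)) = - (\<epsilon> *\<^sub>R B (G (\<theta> \<epsilon>)))"
        by (simp add: B.add B.scaleR eq_neg_iff_add_eq_0)
      then have "(1 / (1 - \<epsilon>)) *\<^sub>R ((1 - \<epsilon>) *\<^sub>R B (F (\<theta> \<epsilon>))) = \<epsilon> *\<^sub>R c \<epsilon>"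
        by (simp only: c_def) (simp add: scaleR_left_commute)
      then have BF: "B (F (\<theta> \<epsilon>)) = \<epsilon> *\<^sub>R c \<epsilon>" using elim(2) by simp
      have qe: "\<theta> \<epsilon> - \<theta>\<^sub>0 = \<epsilon> *\<^sub>R q \<epsilon>" using elim(2) by (simp add: q_def)
      have "norm (\<epsilon> *\<^sub>R c \<epsilon> - \<epsilon> *\<^sub>R q \<epsilon>) \<le> e * norm (\<epsilon> *\<^sub>R q \<epsilon>)"
        using near[of "\<theta> \<epsilon>"] elim(1) unfolding BF qe[symmetric] by (simp add: dist_norm)
      then have "\<epsilon> * norm (c \<epsilon> - q \<epsilon>) \<le> \<epsilon> * (e * norm (q \<epsilon>))"
        using elim(2) by (simp add: scaleR_diff_right[symmetric] ac_simps del: scaleR_diff_right)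
      then show ?case using elim(2) by simp
    qed
  qed
  define K where "K = norm (B (G \<theta>\<^sub>0)) + 1"
  have "\<forall>\<^sub>F \<epsilon> in at_right 0. norm (c \<epsilon>) < K"
    using order_tendstoD(2)[OF tendsto_norm[OF c_lim], of K] by (simp add: K_def)
  then have bounded: "\<forall>\<^sub>F \<epsilon> in at_right 0. norm (q \<epsilon>) \<le> 2 * K"
    using close[of "1/2", OF half_gt_zero[OF zero_less_one]]
  proof eventually_elim
    case (elim \<epsilon>)
    have "norm (q \<epsilon>) \<le> norm (c \<epsilon>) + norm (c \<epsilon> - q \<epsilon>)"
      by (metis norm_minus_commute norm_triangle_sub)
    then show ?case using elim by simp
  qed
  have K: "K > 0" by (simp add: K_def add_nonneg_pos)
  have "((\<lambda>\<epsilon>. c \<epsilon> - q \<epsilon>) \<longlongrightarrow> 0) (at_right 0)"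
  proof (rule tendstoI)
    fix e :: real assume e: "e > 0"
    have "e / (4 * K) > 0" using e K by simp
    from close[OF this] bounded
    show "\<forall>\<^sub>F \<epsilon> in at_right 0. dist (c \<epsilon> - q \<epsilon>) 0 < e"
    proof eventually_elim
      case (elim \<epsilon>)
      have "e / (4 * K) * norm (q \<epsilon>) \<le> e / (4 * K) * (2 * K)"
        using elim(2) e K by (intro mult_left_mono) auto
      also have "\<dots> = e / 2" using K by simp
      finally show ?case using elim(1) e by simp
    qed
  qed
  from tendsto_diff[OF c_lim this] show ?thesis
    unfolding q_def by simp
qed

section \<open>Differentiation under the integral sign\<close>

text \<open>
  Dominated convergence for the normalized remainder of the pointwise first order expansion, which
  is at most \<open>2 K\<close>: one \<open>K\<close> from the Lipschitz bound and one from the bound on the derivative.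
\<close>
lemma has_derivative_integral:
  fixes f :: "'e::euclidean_space \<Rightarrow> 'z \<Rightarrow> 'b::{banach, second_countable_topology}"
  assumes \<rho>: "\<rho> > 0"
    and int: "\<And>\<theta>. \<theta> \<in> cball \<theta>\<^sub>0 \<rho> \<Longrightarrow> integrable M (f \<theta>)"
    and der: "\<And>z. z \<in> space M \<Longrightarrow> ((\<lambda>\<theta>. f \<theta> z) has_derivative f' z) (at \<theta>\<^sub>0)"
    and meas: "\<And>h. (\<lambda>z. f' z h) \<in> borel_measurable M"
    and K: "integrable M K"
    and lip: "\<And>\<theta> z. \<theta> \<in> cball \<theta>\<^sub>0 \<rho> \<Longrightarrow> z \<in> space M \<Longrightarrow> norm (f \<theta> z - f \<theta>\<^sub>0 z) \<le> K z * norm (\<theta> - \<theta>\<^sub>0)"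
    and bound: "\<And>h z. z \<in> space M \<Longrightarrow> norm (f' z h) \<le> K z * norm h"
  shows "((\<lambda>\<theta>. \<integral>z. f \<theta> z \<partial>M) has_derivative (\<lambda>h. \<integral>z. f' z h \<partial>M)) (at \<theta>\<^sub>0)"
proof -
  have int': "integrable M (\<lambda>z. f' z h)" for h
  proof (rule Bochner_Integration.integrable_bound[OF integrable_mult_left[OF K, of "norm h"] meas], rule AE_I2)
    fix z assume "z \<in> space M"
    from bound[OF this, of h] show "norm (f' z h) \<le> norm (K z * norm h)" by (simp add: order_trans[OF _ abs_ge_self])
  qed
  have lin: "linear (f' z)" if "z \<in> space M" for z
    using der[OF that] by (simp add: has_derivative_linear)
  have linI: "linear (\<lambda>h. \<integral>z. f' z h \<partial>M)"
  proof (rule linearI)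
    fix a b
    have "(\<integral>z. f' z (a + b) \<partial>M) = (\<integral>z. f' z a + f' z b \<partial>M)"
      by (intro Bochner_Integration.integral_cong) (auto simp: linear_add[OF lin])
    then show "(\<integral>z. f' z (a + b) \<partial>M) = (\<integral>z. f' z a \<partial>M) + (\<integral>z. f' z b \<partial>M)"
      by (simp add: int')
  next
    fix c :: real and a
    have "(\<integral>z. f' z (c *\<^sub>R a) \<partial>M) = (\<integral>z. c *\<^sub>R f' z a \<partial>M)"
      by (intro Bochner_Integration.integral_cong) (auto simp: linear_scale[OF lin])
    then show "(\<integral>z. f' z (c *\<^sub>R a) \<partial>M) = c *\<^sub>R (\<integral>z. f' z a \<partial>M)"
      by simp
  qed
  let ?R = "\<lambda>\<theta> z. (f \<theta> z - f \<theta>\<^sub>0 z - f' z (\<theta> - \<theta>\<^sub>0)) /\<^sub>R norm (\<theta> - \<theta>\<^sub>0)"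
  have "((\<lambda>\<theta>. \<integral>z. ?R \<theta> z \<partial>M) \<longlongrightarrow> (\<integral>z. 0 \<partial>M)) (at \<theta>\<^sub>0)"
    unfolding tendsto_at_iff_sequentially comp_def
  proof (intro allI impI)
    fix s assume s: "\<forall>i. s i \<in> UNIV - {\<theta>\<^sub>0}" "s \<longlonglongrightarrow> \<theta>\<^sub>0"
    obtain N where N: "\<And>n. n \<ge> N \<Longrightarrow> s n \<in> cball \<theta>\<^sub>0 \<rho>"
      using s(2) \<rho> unfolding LIMSEQ_def by (metis dist_commute less_imp_le mem_cball)
    have "(\<lambda>n. \<integral>z. ?R (s (n + N)) z \<partial>M) \<longlonglongrightarrow> (\<integral>z. 0 \<partial>M)"
    proof (rule integral_dominated_convergence)
      show "integrable M (\<lambda>z. 2 * K z)" using K by simp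
      show "(\<lambda>z. ?R (s (n + N)) z) \<in> borel_measurable M" for n
        using int[OF N[of "n + N"]] int[of \<theta>\<^sub>0] meas \<rho>
        by (intro borel_measurable_scaleR borel_measurable_diff) auto
      show "AE z in M. (\<lambda>n. ?R (s (n + N)) z) \<longlonglongrightarrow> 0"
      proof (rule AE_I2)
        fix z assume "z \<in> space M"
        from der[OF this] have "((\<lambda>\<theta>. ?R \<theta> z) \<longlongrightarrow> 0) (at \<theta>\<^sub>0)"
          by (simp add: has_derivative_def Lim_ident_at netlimit_at)
        then have "(\<lambda>n. ?R (s n) z) \<longlonglongrightarrow> 0"
          using s unfolding tendsto_at_iff_sequentially comp_def by blast
        then show "(\<lambda>n. ?R (s (n + N)) z) \<longlonglongrightarrow> 0" by (rule LIMSEQ_ignore_initial_segment)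
      qed
      show "AE z in M. norm (?R (s (n + N)) z) \<le> 2 * K z" for n
      proof (rule AE_I2)
        fix z assume z: "z \<in> space M"
        let ?\<theta> = "s (n + N)"
        have "norm (f ?\<theta> z - f \<theta>\<^sub>0 z - f' z (?\<theta> - \<theta>\<^sub>0)) \<le> K z * norm (?\<theta> - \<theta>\<^sub>0) + K z * norm (?\<theta> - \<theta>\<^sub>0)"
          by (intro order_trans[OF norm_triangle_ineq4] add_mono lip bound N z) simp
        moreover have "norm (?\<theta> - \<theta>\<^sub>0) > 0" using s(1) by auto
        ultimately show "norm (?R ?\<theta> z) \<le> 2 * K z"
          by (simp add: divide_inverse_commute[symmetric] pos_divide_le_eq)
      qed
    qed simp
    then show "(\<lambda>n. \<integral>z. ?R (s n) z \<partial>M) \<longlonglongrightarrow> (\<integral>z. 0 \<partial>M)"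
      by (rule LIMSEQ_offset)
  qed
  moreover have "\<forall>\<^sub>F \<theta> in at \<theta>\<^sub>0. (\<integral>z. ?R \<theta> z \<partial>M)
      = ((\<integral>z. f \<theta> z \<partial>M) - (\<integral>z. f \<theta>\<^sub>0 z \<partial>M) - (\<integral>z. f' z (\<theta> - \<theta>\<^sub>0) \<partial>M)) /\<^sub>R norm (\<theta> - \<theta>\<^sub>0)"
  proof -
    have "\<forall>\<^sub>F \<theta> in at \<theta>\<^sub>0. \<theta> \<in> cball \<theta>\<^sub>0 \<rho>"
      using \<rho> unfolding eventually_at by (intro exI[of _ \<rho>]) (auto simp: dist_commute)
    then show ?thesis
    proof eventually_elim
      case (elim \<theta>)
      then show ?case using int[OF elim] int[of \<theta>\<^sub>0] \<rho> int'[of "\<theta> - \<theta>\<^sub>0"] by simp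
    qed
  qed
  ultimately have "((\<lambda>\<theta>. ((\<integral>z. f \<theta> z \<partial>M) - (\<integral>z. f \<theta>\<^sub>0 z \<partial>M) - (\<integral>z. f' z (\<theta> - \<theta>\<^sub>0) \<partial>M))
      /\<^sub>R norm (\<theta> - \<theta>\<^sub>0)) \<longlongrightarrow> (\<integral>z. 0 \<partial>M)) (at \<theta>\<^sub>0)"
    by (rule Lim_transform_eventually)
  then show ?thesis
    using linI unfolding has_derivative_def linear_conv_bounded_linear
    by (simp add: netlimit_at)
qed

section \<open>Integrals with respect to contaminated measures\<close>

text \<open>
  To draw from the mixture, toss a coin with success probability \<open>\<epsilon>\<close> and return \<open>z\<close> in case of success,
  a draw from \<open>P\<close> otherwise. In this form the mixture is a measure by construction, and
  integrals with respect to it follow from Fubini's theorem.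
\<close>
lemma contaminated_eq_distr:
  fixes P :: "'z measure"
  assumes "prob_space P" and z: "z \<in> space P" and \<epsilon>: "0 \<le> \<epsilon>" "\<epsilon> \<le> 1"
  shows "contaminated P z \<epsilon> =
    distr (measure_pmf (bernoulli_pmf \<epsilon>) \<Otimes>\<^sub>M P) P (\<lambda>(c, w). if c then z else w)"
proof -
  interpret prob_space P by fact
  let ?N = "distr (measure_pmf (bernoulli_pmf \<epsilon>) \<Otimes>\<^sub>M P) P (\<lambda>(c, w). if c then z else w)"
  have g: "(\<lambda>(c, w). if c then z else w) \<in> measurable (measure_pmf (bernoulli_pmf \<epsilon>) \<Otimes>\<^sub>M P) P"
    using z unfolding case_prod_beta by measurable
  have "emeasure ?N A = ennreal (1 - \<epsilon>) * emeasure P A + ennreal \<epsilon> * emeasure (return P z) A"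
    if A: "A \<in> sets P" for A
  proof -
    have "emeasure ?N A = (\<integral>\<^sup>+v. indicator A v \<partial>?N)" using A by simp
    also have "\<dots> = (\<integral>\<^sup>+v. indicator A ((\<lambda>(c, w). if c then z else w) v) \<partial>(measure_pmf (bernoulli_pmf \<epsilon>) \<Otimes>\<^sub>M P))"
      using A by (intro nn_integral_distr g) auto
    also have "\<dots> = (\<integral>\<^sup>+c. \<integral>\<^sup>+w. indicator A (if c then z else w) \<partial>P \<partial>measure_pmf (bernoulli_pmf \<epsilon>))"
      using A by (subst nn_integral_fst[symmetric]) (auto intro!: measurable_compose[OF g])
    also have "\<dots> = ennreal (1 - \<epsilon>) * emeasure P A + ennreal \<epsilon> * emeasure (return P z) A"
      using \<epsilon> A by (simp add: emeasure_space_1 mult.commute add.commute)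
    finally show ?thesis .
  qed
  then have "contaminated P z \<epsilon> = measure_of (space P) (sets P) (emeasure ?N)"
    unfolding contaminated_def
    by (intro measure_of_eq) (auto simp: sets.space_closed sets.sigma_sets_eq)
  also have "\<dots> = measure_of (space ?N) (sets ?N) (emeasure ?N)" by simp
  also have "\<dots> = ?N" by (rule measure_of_of_measure)
  finally show ?thesis .
qed

lemma prob_space_contaminated:
  assumes "prob_space P" and "z \<in> space P" and "0 \<le> \<epsilon>" "\<epsilon> \<le> 1"
  shows "prob_space (contaminated P z \<epsilon>)"
proof -
  interpret prob_space P by fact
  interpret pair_prob_space "measure_pmf (bernoulli_pmf \<epsilon>)" P ..
  show ?thesis unfolding contaminated_eq_distr[OF assms]
    by (rule prob_space_distr) (use \<open>z \<in> space P\<close> in \<open>unfold case_prod_beta, measurable\<close>)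
qed

lemma sets_contaminated [simp]: "sets (contaminated P z \<epsilon>) = sets P"
  by (simp add: contaminated_def sets.space_closed sets.sigma_sets_eq)

lemma has_bochner_integral_contaminated:
  fixes f :: "'z \<Rightarrow> 'b::{banach, second_countable_topology}"
  assumes "prob_space P" and z: "z \<in> space P" and \<epsilon>: "0 \<le> \<epsilon>" "\<epsilon> \<le> 1"
    and f: "integrable P f"
  shows "has_bochner_integral (contaminated P z \<epsilon>) f ((1 - \<epsilon>) *\<^sub>R (\<integral>w. f w \<partial>P) + \<epsilon> *\<^sub>R f z)"
proof -
  interpret prob_space P by fact
  let ?B = "measure_pmf (bernoulli_pmf \<epsilon>)"
  interpret pair_prob_space ?B P ..
  let ?g = "\<lambda>(c, w). if c then z else w"
  have g[measurable]: "?g \<in> measurable (?B \<Otimes>\<^sub>M P) P"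
    using z unfolding case_prod_beta by measurable
  have [measurable]: "f \<in> borel_measurable P" using f by simp
  have fin: "finite (set_pmf (bernoulli_pmf \<epsilon>))" by simp
  have *: "integrable P (\<lambda>w. f (if c then z else w))" for c using f by (cases c) auto
  have int: "integrable (?B \<Otimes>\<^sub>M P) (\<lambda>v. f (?g v))"
    using * by (intro Fubini_integrable integrable_measure_pmf_finite fin AE_I2) auto
  have "(\<integral>v. f (?g v) \<partial>(?B \<Otimes>\<^sub>M P)) = (\<integral>c. \<integral>w. f (if c then z else w) \<partial>P \<partial>?B)"
    by (subst integral_fst'[OF int, symmetric]) simp
  also have "\<dots> = (1 - \<epsilon>) *\<^sub>R (\<integral>w. f w \<partial>P) + \<epsilon> *\<^sub>R f z"
    using \<epsilon> by (subst integral_measure_pmf[of UNIV]) (auto simp: UNIV_bool prob_space.prob_space[OF assms(1)])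
  finally have "has_bochner_integral (?B \<Otimes>\<^sub>M P) (\<lambda>v. f (?g v)) ((1 - \<epsilon>) *\<^sub>R (\<integral>w. f w \<partial>P) + \<epsilon> *\<^sub>R f z)"
    using int by (simp add: has_bochner_integral_iff)
  then show ?thesis unfolding contaminated_eq_distr[OF assms(1-4)]
    by (intro has_bochner_integral_distr) auto
qed

section \<open>Integrals of vector-valued functions\<close>

lemma has_bochner_integral_Pair:
  fixes f :: "'a \<Rightarrow> 'b::{banach, second_countable_topology}"
    and g :: "'a \<Rightarrow> 'c::{banach, second_countable_topology}"
  assumes "has_bochner_integral M f a" and "has_bochner_integral M g b"
  shows "has_bochner_integral M (\<lambda>x. (f x, g x)) (a, b)"
proof -
  have 1: "bounded_linear (\<lambda>v::'b. (v, 0::'c))" and 2: "bounded_linear (\<lambda>v::'c. (0::'b, v))"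
    by (intro bounded_linear_Pair bounded_linear_ident bounded_linear_zero)+
  show ?thesis
    using has_bochner_integral_add[OF has_bochner_integral_bounded_linear[OF 1 assms(1)]
        has_bochner_integral_bounded_linear[OF 2 assms(2)]] by simp
qed

lemma has_bochner_integral_componentwise:
  fixes f :: "'a \<Rightarrow> 'e::euclidean_space"
  assumes "\<And>b. b \<in> Basis \<Longrightarrow> has_bochner_integral M (\<lambda>x. f x \<bullet> b) (I \<bullet> b)"
  shows "has_bochner_integral M f I"
proof -
  have "has_bochner_integral M (\<lambda>x. \<Sum>b\<in>Basis. (f x \<bullet> b) *\<^sub>R b) (\<Sum>b\<in>Basis. (I \<bullet> b) *\<^sub>R b)"
    by (intro has_bochner_integral_sum has_bochner_integral_scaleR_left assms)
  then show ?thesis by (simp add: euclidean_representation)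
qed

section \<open>Exponentially weighted normal moments\<close>

text \<open>
  The exponential weight common to the two estimating functions turns the normal density into another
  one, with variance smaller by the factor \<open>\<alpha> + 1\<close> and total mass \<open>1 / sqrt (\<alpha> + 1)\<close>. This is the origin of
  all powers of \<open>\<alpha> + 1\<close> in the influence functions.
\<close>
lemma normal_density_tilt:
  assumes "\<sigma> > 0" and "\<alpha> > 0"
  shows "normal_density 0 \<sigma> u * exp (- (\<alpha> / 2) * (u / \<sigma>)\<^sup>2)
    = normal_density 0 (\<sigma> / sqrt (\<alpha> + 1)) u / sqrt (\<alpha> + 1)"
proof -
  have "- u\<^sup>2 / (2 * \<sigma>\<^sup>2) + - (\<alpha> / 2) * (u / \<sigma>)\<^sup>2 = - u\<^sup>2 / (2 * (\<sigma> / sqrt (\<alpha> + 1))\<^sup>2)"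
    using assms by (simp add: power_divide field_simps)
  then have e: "exp (- u\<^sup>2 / (2 * \<sigma>\<^sup>2)) * exp (- (\<alpha> / 2) * (u / \<sigma>)\<^sup>2)
      = exp (- u\<^sup>2 / (2 * (\<sigma> / sqrt (\<alpha> + 1))\<^sup>2))"
    by (simp only: exp_add[symmetric])
  have "sqrt (2 * pi * (\<sigma> / sqrt (\<alpha> + 1))\<^sup>2) * sqrt (\<alpha> + 1) = sqrt (2 * pi * \<sigma>\<^sup>2)"
    using assms by (simp add: real_sqrt_mult[symmetric] power_divide)
  then show ?thesis
    unfolding normal_density_def diff_0_right e[symmetric] by (simp add: field_simps)
qed

lemma gaussian_tilted_moment:
  assumes "\<sigma> > 0" and "\<alpha> > 0"
  shows "has_bochner_integral lborel
    (\<lambda>u. normal_density 0 \<sigma> u * ((u / \<sigma>) ^ (2 * k) * exp (- (\<alpha> / 2) * (u / \<sigma>)\<^sup>2)))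
    (fact (2 * k) / (2 ^ k * fact k) / ((\<alpha> + 1) ^ k * sqrt (\<alpha> + 1)))"
proof -
  have f: "(normal_density 0 (\<sigma> / sqrt (\<alpha> + 1)) u * (u - 0) ^ (2 * k)) * (1 / (\<sigma> ^ (2 * k) * sqrt (\<alpha> + 1)))
      = normal_density 0 \<sigma> u * ((u / \<sigma>) ^ (2 * k) * exp (- (\<alpha> / 2) * (u / \<sigma>)\<^sup>2))" for u
  proof -
    have "normal_density 0 \<sigma> u * ((u / \<sigma>) ^ (2 * k) * exp (- (\<alpha> / 2) * (u / \<sigma>)\<^sup>2))
      = (normal_density 0 \<sigma> u * exp (- (\<alpha> / 2) * (u / \<sigma>)\<^sup>2)) * (u / \<sigma>) ^ (2 * k)"
      by (simp only: ac_simps)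
    then show ?thesis
      unfolding normal_density_tilt[OF assms] by (simp add: power_divide)
  qed
  have v: "(fact (2 * k) / ((2 / (\<sigma> / sqrt (\<alpha> + 1))\<^sup>2) ^ k * fact k)) * (1 / (\<sigma> ^ (2 * k) * sqrt (\<alpha> + 1)))
      = fact (2 * k) / (2 ^ k * fact k) / ((\<alpha> + 1) ^ k * sqrt (\<alpha> + 1))"
    using assms by (simp add: power_divide power_mult power_mult_distrib[symmetric])
  have "has_bochner_integral lborel
      (\<lambda>u. (normal_density 0 (\<sigma> / sqrt (\<alpha> + 1)) u * (u - 0) ^ (2 * k)) * (1 / (\<sigma> ^ (2 * k) * sqrt (\<alpha> + 1))))
      ((fact (2 * k) / ((2 / (\<sigma> / sqrt (\<alpha> + 1))\<^sup>2) ^ k * fact k)) * (1 / (\<sigma> ^ (2 * k) * sqrt (\<alpha> + 1))))"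
    using assms by (intro has_bochner_integral_mult_left normal_moment_even) auto
  then show ?thesis unfolding f v .
qed

text \<open>Substituting \<open>- u\<close> for \<open>u\<close> shows that the integral equals its own negative.\<close>
lemma gaussian_odd_integral_zero:
  fixes g :: "real \<Rightarrow> real"
  assumes odd: "\<And>u. g (- u) = - g u"
  shows "(\<integral>u. normal_density 0 \<sigma> u * g u \<partial>lborel) = 0"
  using lborel_integral_real_affine[of "-1" "\<lambda>u. normal_density 0 \<sigma> u * g u" 0]
  by (simp add: odd normal_density_def)

text \<open>
  With \<open>t = \<alpha> u\<^sup>2 / 2\<close>, combine \<open>|u| ^ k \<le> 1 + u ^ (2 k)\<close> and \<open>t ^ k \<le> k! exp t\<close>.
\<close>
lemma gaussian_power_bounded:
  fixes \<alpha> :: real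
  assumes "\<alpha> > 0"
  obtains C where "\<And>u. \<bar>u ^ k * exp (- (\<alpha> / 2) * u\<^sup>2)\<bar> \<le> C"
proof -
  have "\<bar>u ^ k * exp (- (\<alpha> / 2) * u\<^sup>2)\<bar> \<le> 1 + fact k * (2 / \<alpha>) ^ k" for u :: real
  proof -
    define t where "t = \<alpha> / 2 * u\<^sup>2"
    have t: "t \<ge> 0" using assms by (simp add: t_def)
    have "(\<Sum>n\<in>{k}. t ^ n /\<^sub>R fact n) \<le> exp t"
      unfolding exp_def using t by (intro sum_le_suminf summable_exp_generic) auto
    then have tk: "t ^ k * exp (- t) \<le> fact k" by (simp add: exp_minus field_simps)
    \<comment> \<open>Pass to an even power, which is a power of \<open>t\<close>.\<close>
    have "\<bar>u\<bar> ^ k \<le> 1 + (u\<^sup>2) ^ k"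
    proof (cases "\<bar>u\<bar> \<le> 1")
      case True
      then have "\<bar>u\<bar> ^ k \<le> 1" by (simp add: power_le_one)
      then show ?thesis by (simp add: add_increasing2)
    next
      case False
      then have "\<bar>u\<bar> ^ k \<le> \<bar>u\<bar> ^ (2 * k)" by (intro power_increasing) auto
      then show ?thesis by (simp add: power_mult)
    qed
    also have "(u\<^sup>2) ^ k = t ^ k * (2 / \<alpha>) ^ k"
      using assms by (simp add: t_def power_mult_distrib[symmetric])
    finally have "\<bar>u\<bar> ^ k * exp (- t) \<le> (1 + t ^ k * (2 / \<alpha>) ^ k) * exp (- t)"
      by (intro mult_right_mono) auto
    also have "\<dots> = exp (- t) + (t ^ k * exp (- t)) * (2 / \<alpha>) ^ k" by (simp add: algebra_simps)
    also have "\<dots> \<le> 1 + fact k * (2 / \<alpha>) ^ k"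
      using t tk assms by (intro add_mono mult_right_mono) auto
    finally show ?thesis by (simp add: t_def abs_mult power_abs)
  qed
  then show thesis by (rule that)
qed

section \<open>The score and its derivative\<close>

definition minR_phi' :: "real \<Rightarrow> real \<Rightarrow> real" where
  "minR_phi' \<alpha> u = (1 - \<alpha> * u\<^sup>2) * exp (- (\<alpha> / 2) * u\<^sup>2)"

definition minR_chi' :: "real \<Rightarrow> real \<Rightarrow> real" where
  "minR_chi' \<alpha> u = (2 + \<alpha> / (\<alpha> + 1) - \<alpha> * u\<^sup>2) * u * exp (- (\<alpha> / 2) * u\<^sup>2)"

lemma minR_phi_deriv: "(minR_phi \<alpha> has_real_derivative minR_phi' \<alpha> u) (at u)"
  unfolding minR_phi_def[abs_def] minR_phi'_def
  by (auto intro!: derivative_eq_intros simp: power2_eq_square algebra_simps)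

lemma minR_chi_deriv: "(minR_chi \<alpha> has_real_derivative minR_chi' \<alpha> u) (at u)"
proof -
  have "((\<lambda>u. (u\<^sup>2 - c) * exp (- (\<alpha> / 2) * u\<^sup>2)) has_real_derivative
      (2 + \<alpha> * c - \<alpha> * u\<^sup>2) * u * exp (- (\<alpha> / 2) * u\<^sup>2)) (at u)" for c
    by (auto intro!: derivative_eq_intros simp: power2_eq_square algebra_simps)
  from this[of "1 / (\<alpha> + 1)"] show ?thesis
    by (simp add: minR_chi_def[abs_def] minR_chi'_def)
qed

text \<open>Each of the four is a linear combination of at most two functions \<open>u ^ k * exp (- (\<alpha> / 2) * u\<^sup>2)\<close>.\<close>
lemma
  assumes "\<alpha> > 0"
  shows minR_phi_bounded: "\<exists>C. \<forall>u. \<bar>minR_phi \<alpha> u\<bar> \<le> C"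
    and minR_chi_bounded: "\<exists>C. \<forall>u. \<bar>minR_chi \<alpha> u\<bar> \<le> C"
    and minR_phi'_bounded: "\<exists>C. \<forall>u. \<bar>minR_phi' \<alpha> u\<bar> \<le> C"
    and minR_chi'_bounded: "\<exists>C. \<forall>u. \<bar>minR_chi' \<alpha> u\<bar> \<le> C"
proof -
  let ?e = "\<lambda>k u::real. u ^ k * exp (- (\<alpha> / 2) * u\<^sup>2)"
  have comb: "\<exists>C. \<forall>u. \<bar>a * ?e j u + b * ?e k u\<bar> \<le> C" for a b j k
  proof -
    obtain C where C: "\<And>u. \<bar>?e j u\<bar> \<le> C" using gaussian_power_bounded[OF assms, of j] by metis
    obtain D where D: "\<And>u. \<bar>?e k u\<bar> \<le> D" using gaussian_power_bounded[OF assms, of k] by metis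
    have "\<bar>a * ?e j u + b * ?e k u\<bar> \<le> \<bar>a\<bar> * C + \<bar>b\<bar> * D" for u
      by (rule order_trans[OF abs_triangle_ineq]) (unfold abs_mult[of a] abs_mult[of b], intro add_mono mult_left_mono C D abs_ge_zero)
    then show ?thesis by blast
  qed
  show "\<exists>C. \<forall>u. \<bar>minR_phi \<alpha> u\<bar> \<le> C"
    using comb[of 1 1 0 0] by (simp add: minR_phi_def)
  show "\<exists>C. \<forall>u. \<bar>minR_chi \<alpha> u\<bar> \<le> C"
    using comb[of 1 2 "- 1 / (\<alpha> + 1)" 0] by (simp add: minR_chi_def left_diff_distrib)
  show "\<exists>C. \<forall>u. \<bar>minR_phi' \<alpha> u\<bar> \<le> C"
    using comb[of 1 0 "- \<alpha>" 2] by (simp add: minR_phi'_def left_diff_distrib mult.assoc)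
  show "\<exists>C. \<forall>u. \<bar>minR_chi' \<alpha> u\<bar> \<le> C"
    using comb[of "2 + \<alpha> / (\<alpha> + 1)" 1 "- \<alpha>" 3]
    by (simp add: minR_chi'_def left_diff_distrib mult.assoc power2_eq_square power3_eq_cube)
qed

lemma lipschitz_if_bounded_real_derivative:
  fixes g g' :: "real \<Rightarrow> real"
  assumes "\<And>u. (g has_real_derivative g' u) (at u)" and "\<And>u. \<bar>g' u\<bar> \<le> L"
  shows "\<bar>g u - g v\<bar> \<le> L * \<bar>u - v\<bar>"
  using field_differentiable_bound[of UNIV g g' L u v] assms by (simp)

text \<open>
  The two estimating functions as a single map with values in the parameter space, so that the
  estimating equations become one equation between vectors of equal dimension.
\<close>
definition minR_score :: "real \<Rightarrow> (real ^ 'p::finite) \<times> real \<Rightarrow> (real ^ 'p) \<times> real \<Rightarrow> (real ^ 'p) \<times> real" where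
  "minR_score \<alpha> \<theta> z = (minR_phi \<alpha> ((snd z - fst \<theta> \<bullet> fst z) / snd \<theta>) *\<^sub>R fst z,
     minR_chi \<alpha> ((snd z - fst \<theta> \<bullet> fst z) / snd \<theta>))"

lemma minR_solution_iff_score:
  "minR_solution \<alpha> P b s \<longleftrightarrow> s > 0 \<and> has_bochner_integral P (minR_score \<alpha> (b, s)) 0"
proof -
  let ?f = "\<lambda>z. minR_phi \<alpha> ((snd z - b \<bullet> fst z) / s) *\<^sub>R fst z"
  let ?g = "\<lambda>z. minR_chi \<alpha> ((snd z - b \<bullet> fst z) / s)"
  have eq: "minR_score \<alpha> (b, s) = (\<lambda>z. (?f z, ?g z))" by (simp add: minR_score_def fun_eq_iff)
  have "has_bochner_integral P ?f 0 \<and> has_bochner_integral P ?g 0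
    \<longleftrightarrow> has_bochner_integral P (\<lambda>z. (?f z, ?g z)) 0"
    using has_bochner_integral_Pair[of P ?f 0 ?g 0]
      has_bochner_integral_fst[of P "\<lambda>z. (?f z, ?g z)" 0] has_bochner_integral_snd[of P "\<lambda>z. (?f z, ?g z)" 0]
    by (auto simp: zero_prod_def)
  then show ?thesis unfolding minR_solution_def eq case_prod_beta by simp
qed

lemma continuous_on_minR_score:
  assumes "\<And>v. v \<in> S \<Longrightarrow> snd (t v) \<noteq> 0" and "continuous_on S t" and "continuous_on S z"
  shows "continuous_on S (\<lambda>v. minR_score \<alpha> (t v) (z v))"
  unfolding minR_score_def minR_phi_def minR_chi_def
  by (intro continuous_intros assms) (use assms(1) in auto)

lemma minR_score_bounded:
  assumes "\<alpha> > 0"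
  obtains C where "C \<ge> 0" and "\<And>\<theta> z. norm (minR_score \<alpha> \<theta> z) \<le> C * (1 + norm (fst z))"
proof -
  obtain C\<^sub>1 where C1: "\<And>u. \<bar>minR_phi \<alpha> u\<bar> \<le> C\<^sub>1" using minR_phi_bounded[OF assms] by blast
  obtain C\<^sub>2 where C2: "\<And>u. \<bar>minR_chi \<alpha> u\<bar> \<le> C\<^sub>2" using minR_chi_bounded[OF assms] by blast
  define C where "C = max C\<^sub>1 C\<^sub>2"
  have C: "\<bar>minR_phi \<alpha> u\<bar> \<le> C" "\<bar>minR_chi \<alpha> u\<bar> \<le> C" for u
    using C1 C2 by (auto simp: C_def le_max_iff_disj)
  have "norm (minR_score \<alpha> \<theta> z) \<le> C * (1 + norm (fst z))" for \<theta> z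
  proof -
    let ?r = "(snd z - fst \<theta> \<bullet> fst z) / snd \<theta>"
    have "norm (minR_score \<alpha> \<theta> z) \<le> \<bar>minR_phi \<alpha> ?r\<bar> * norm (fst z) + \<bar>minR_chi \<alpha> ?r\<bar>"
      unfolding minR_score_def by (rule order_trans[OF norm_Pair_le]) simp
    also have "\<dots> \<le> C * norm (fst z) + C"
      by (intro add_mono mult_right_mono C) simp
    finally show ?thesis by (simp add: algebra_simps)
  qed
  then show thesis using that[of C] C(1)[of 0] abs_ge_zero[of "minR_phi \<alpha> 0"] by (meson order_trans)
qed

text \<open>
  The derivative in direction \<open>\<eta>\<close> by the chain rule: \<open>dr\<close> is the directional derivative of the
  standardized residual \<open>r\<close>.
\<close>
definition minR_score' :: "real \<Rightarrow> (real ^ 'p::finite) \<times> real \<Rightarrow> (real ^ 'p) \<times> real \<Rightarrow> (real ^ 'p) \<times> real \<Rightarrow> (real ^ 'p) \<times> real" where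
  "minR_score' \<alpha> \<theta> z \<eta> =
    (let r = (snd z - fst \<theta> \<bullet> fst z) / snd \<theta>; dr = - (fst \<eta> \<bullet> fst z + snd \<eta> * r) / snd \<theta>
     in ((minR_phi' \<alpha> r * dr) *\<^sub>R fst z, minR_chi' \<alpha> r * dr))"

lemma minR_score_has_derivative:
  assumes "snd \<theta>\<^sub>0 \<noteq> 0"
  shows "((\<lambda>\<theta>. minR_score \<alpha> \<theta> z) has_derivative minR_score' \<alpha> \<theta>\<^sub>0 z) (at \<theta>\<^sub>0)"
proof -
  let ?r = "\<lambda>\<theta>. (snd z - fst \<theta> \<bullet> fst z) / snd \<theta>"
  let ?dr = "\<lambda>\<eta>. - (fst \<eta> \<bullet> fst z + snd \<eta> * ?r \<theta>\<^sub>0) / snd \<theta>\<^sub>0"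
  have r: "(?r has_derivative ?dr) (at \<theta>\<^sub>0)"
    using assms by (auto intro!: derivative_eq_intros simp: fun_eq_iff field_simps)
  have g: "((\<lambda>\<theta>. g (?r \<theta>)) has_derivative (\<lambda>\<eta>. g' (?r \<theta>\<^sub>0) * ?dr \<eta>)) (at \<theta>\<^sub>0)"
    if "\<And>u. (g has_real_derivative g' u) (at u)" for g g'
    using has_derivative_compose[OF r that[unfolded has_field_derivative_def]] .
  show ?thesis
    unfolding minR_score_def minR_score'_def Let_def
    by (intro has_derivative_Pair has_derivative_scaleR_left g minR_phi_deriv minR_chi_deriv)
qed

text \<open>
  As \<open>minR_phi\<close> and \<open>minR_chi\<close> have bounded derivatives, the score moves by at most a constant times
  \<open>1 + |x|\<close> times the change of the standardized residual. Writing \<open>r\<^sub>0\<close> for the residual at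
  \<open>\<theta>\<^sub>0\<close>, that change is at most \<open>(|x| + |r\<^sub>0|) |\<theta> - \<theta>\<^sub>0| / s\<close>, and \<open>s\<close> stays above half its
  value at \<open>\<theta>\<^sub>0\<close> on the ball. The bound is quadratic in \<open>(x, r\<^sub>0)\<close>, hence integrable as soon as second
  moments exist; the derivative satisfies the same bound.
\<close>
lemma minR_score_lipschitz:
  assumes "\<alpha> > 0" and s0: "snd \<theta>\<^sub>0 > 0"
  obtains L where
    "\<And>\<theta> z. \<theta> \<in> cball \<theta>\<^sub>0 (snd \<theta>\<^sub>0 / 2) \<Longrightarrow>
      norm (minR_score \<alpha> \<theta> z - minR_score \<alpha> \<theta>\<^sub>0 z)
        \<le> L * ((1 + norm (fst z)) * (norm (fst z) + \<bar>(snd z - fst \<theta>\<^sub>0 \<bullet> fst z) / snd \<theta>\<^sub>0\<bar>)) * norm (\<theta> - \<theta>\<^sub>0)"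
    "\<And>z \<eta>. norm (minR_score' \<alpha> \<theta>\<^sub>0 z \<eta>)
        \<le> L * ((1 + norm (fst z)) * (norm (fst z) + \<bar>(snd z - fst \<theta>\<^sub>0 \<bullet> fst z) / snd \<theta>\<^sub>0\<bar>)) * norm \<eta>"
proof -
  obtain L\<^sub>1 where L1: "\<And>u. \<bar>minR_phi' \<alpha> u\<bar> \<le> L\<^sub>1" using minR_phi'_bounded[OF assms(1)] by blast
  obtain L\<^sub>2 where L2: "\<And>u. \<bar>minR_chi' \<alpha> u\<bar> \<le> L\<^sub>2" using minR_chi'_bounded[OF assms(1)] by blast
  define L where "L = max L\<^sub>1 L\<^sub>2"
  have L: "\<bar>minR_phi' \<alpha> u\<bar> \<le> L" "\<bar>minR_chi' \<alpha> u\<bar> \<le> L" for u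
    using L1 L2 by (auto simp: L_def le_max_iff_disj)
  have L0: "L \<ge> 0" using L(1)[of 0] by linarith
  define s where "s = snd \<theta>\<^sub>0"
  have s: "s > 0" using s0 by (simp add: s_def)
  let ?r = "\<lambda>\<theta> z. (snd z - fst \<theta> \<bullet> fst z) / snd \<theta>"
  have lin: "\<bar>fst \<eta> \<bullet> fst z + snd \<eta> * r\<bar> \<le> (norm (fst z) + \<bar>r\<bar>) * norm \<eta>"
    for \<eta> z :: "(real ^ 'b) \<times> real" and r
  proof -
    have "\<bar>fst \<eta> \<bullet> fst z + snd \<eta> * r\<bar> \<le> norm (fst \<eta>) * norm (fst z) + \<bar>snd \<eta>\<bar> * \<bar>r\<bar>"
      by (rule order_trans[OF abs_triangle_ineq]) (intro add_mono Cauchy_Schwarz_ineq2, simp add: abs_mult)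
    also have "\<dots> \<le> norm \<eta> * norm (fst z) + norm \<eta> * \<bar>r\<bar>"
      using norm_fst_le[of "fst \<eta>" "snd \<eta>"] norm_snd_le[of "snd \<eta>" "fst \<eta>"]
      by (intro add_mono mult_right_mono) auto
    finally show ?thesis by (simp add: algebra_simps)
  qed
  have pair: "norm (a *\<^sub>R fst z, b) \<le> L * (1 + norm (fst z)) * t"
    if "\<bar>a\<bar> \<le> L * t" "\<bar>b\<bar> \<le> L * t" for a b t and z :: "(real ^ 'b) \<times> real"
  proof -
    have "norm (a *\<^sub>R fst z, b) \<le> \<bar>a\<bar> * norm (fst z) + \<bar>b\<bar>"
      by (rule order_trans[OF norm_Pair_le]) simp
    also have "\<dots> \<le> L * t * norm (fst z) + L * t" by (intro add_mono mult_right_mono that) simp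
    finally show ?thesis by (simp add: algebra_simps)
  qed
  have half: "a * b / (s / 2) = 2 / s * a * b" for a b by simp
  let ?k = "\<lambda>z. norm (fst z) + \<bar>?r \<theta>\<^sub>0 z\<bar>"
  show thesis
  proof (rule that[of "L * (2 / s)"])
    fix \<theta> z assume \<theta>: "\<theta> \<in> cball \<theta>\<^sub>0 (snd \<theta>\<^sub>0 / 2)"
    have "\<bar>snd \<theta> - s\<bar> \<le> s / 2"
      using \<theta> dist_snd_le[of \<theta> \<theta>\<^sub>0] by (simp add: s_def dist_real_def dist_commute)
    then have s\<theta>: "snd \<theta> \<ge> s / 2" "snd \<theta> > 0" using s by linarith+
    define t where "t = 2 / s * ?k z * norm (\<theta> - \<theta>\<^sub>0)"
    have "?r \<theta> z - ?r \<theta>\<^sub>0 z = - (fst (\<theta> - \<theta>\<^sub>0) \<bullet> fst z + snd (\<theta> - \<theta>\<^sub>0) * ?r \<theta>\<^sub>0 z) / snd \<theta>"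
      using s s\<theta> by (simp add: s_def[symmetric] inner_diff_left field_simps)
    then have "\<bar>?r \<theta> z - ?r \<theta>\<^sub>0 z\<bar> = \<bar>fst (\<theta> - \<theta>\<^sub>0) \<bullet> fst z + snd (\<theta> - \<theta>\<^sub>0) * ?r \<theta>\<^sub>0 z\<bar> / snd \<theta>"
      using s s\<theta> by (simp only: abs_divide abs_minus abs_of_pos)
    also have "\<dots> \<le> (?k z * norm (\<theta> - \<theta>\<^sub>0)) / (s / 2)"
      using s s\<theta> by (intro frac_le lin mult_nonneg_nonneg add_nonneg_nonneg) auto
    finally have r: "\<bar>?r \<theta> z - ?r \<theta>\<^sub>0 z\<bar> \<le> t" unfolding half t_def .
    have phi: "\<bar>minR_phi \<alpha> (?r \<theta> z) - minR_phi \<alpha> (?r \<theta>\<^sub>0 z)\<bar> \<le> L * t"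
      by (rule order_trans[OF lipschitz_if_bounded_real_derivative[OF minR_phi_deriv L(1)] mult_left_mono[OF r L0]])
    have chi: "\<bar>minR_chi \<alpha> (?r \<theta> z) - minR_chi \<alpha> (?r \<theta>\<^sub>0 z)\<bar> \<le> L * t"
      by (rule order_trans[OF lipschitz_if_bounded_real_derivative[OF minR_chi_deriv L(2)] mult_left_mono[OF r L0]])
    from pair[OF phi chi, of z]
    show "norm (minR_score \<alpha> \<theta> z - minR_score \<alpha> \<theta>\<^sub>0 z)
        \<le> L * (2 / s) * ((1 + norm (fst z)) * ?k z) * norm (\<theta> - \<theta>\<^sub>0)"
      by (simp add: minR_score_def t_def scaleR_diff_left ac_simps)
  next
    fix z \<eta>
    define dr where "dr = - (fst \<eta> \<bullet> fst z + snd \<eta> * ?r \<theta>\<^sub>0 z) / s"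
    define t where "t = 2 / s * ?k z * norm \<eta>"
    have "\<bar>dr\<bar> = \<bar>fst \<eta> \<bullet> fst z + snd \<eta> * ?r \<theta>\<^sub>0 z\<bar> / s"
      using s unfolding dr_def by (simp only: abs_divide abs_minus abs_of_pos)
    also have "\<dots> \<le> (?k z * norm \<eta>) / (s / 2)"
      using s by (intro frac_le lin mult_nonneg_nonneg add_nonneg_nonneg) auto
    finally have r: "\<bar>dr\<bar> \<le> t" unfolding half t_def .
    have "\<bar>minR_phi' \<alpha> (?r \<theta>\<^sub>0 z) * dr\<bar> \<le> L * t" "\<bar>minR_chi' \<alpha> (?r \<theta>\<^sub>0 z) * dr\<bar> \<le> L * t"
      unfolding abs_mult by (intro mult_mono L r L0 abs_ge_zero)+
    from pair[OF this, of z]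
    show "norm (minR_score' \<alpha> \<theta>\<^sub>0 z \<eta>) \<le> L * (2 / s) * ((1 + norm (fst z)) * ?k z) * norm \<eta>"
      unfolding minR_score'_def Let_def t_def dr_def s_def[symmetric] by (simp only: ac_simps)
  qed
qed

section \<open>The regression model\<close>

lemma invertible_if_quadratic_form_pos:
  fixes V :: "real ^ 'p ^ 'p"
  assumes "\<And>h. h \<noteq> 0 \<Longrightarrow> h \<bullet> (V *v h) > 0"
  shows "matrix_inv V ** V = mat 1" and "V ** matrix_inv V = mat 1"
proof -
  have "\<forall>h. V *v h = 0 \<longrightarrow> h = 0" using assms by (metis inner_zero_right less_irrefl)
  then obtain W where W: "W ** V = mat 1" by (metis matrix_left_invertible_ker)
  then have "\<exists>W. V ** W = mat 1 \<and> W ** V = mat 1" using matrix_left_right_inverse by blast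
  then have "V ** matrix_inv V = mat 1 \<and> matrix_inv V ** V = mat 1"
    unfolding matrix_inv_def by (rule someI_ex)
  then show "matrix_inv V ** V = mat 1" and "V ** matrix_inv V = mat 1" by auto
qed

locale gaussian_linear_model = prob_space M for M :: "'a measure" +
  fixes X :: "'a \<Rightarrow> real ^ 'p::finite" and U :: "'a \<Rightarrow> real"
    and \<beta> :: "real ^ 'p" and \<sigma> \<alpha> :: real
  assumes \<alpha>_pos: "\<alpha> > 0" and \<sigma>_pos: "\<sigma> > 0"
    and X_measurable [measurable]: "X \<in> borel_measurable M"
    and U_distr: "distributed M lborel U (normal_density 0 \<sigma>)"
    and indep: "indep_set {X -` A \<inter> space M | A. A \<in> sets borel} {U -` B \<inter> space M | B. B \<in> sets borel}"
    and nondegenerate: "\<And>a. a \<noteq> 0 \<Longrightarrow> prob {\<omega> \<in> space M. a \<bullet> X \<omega> = 0} < 1"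
    and X_square_integrable: "\<And>i j. integrable M (\<lambda>\<omega>. X \<omega> $ i * X \<omega> $ j)"
begin

definition model :: "((real ^ 'p) \<times> real) measure" where
  "model = distr M borel (\<lambda>\<omega>. (X \<omega>, \<beta> \<bullet> X \<omega> + U \<omega>))"

definition mean_score :: "(real ^ 'p) \<times> real \<Rightarrow> (real ^ 'p) \<times> real" where
  "mean_score \<theta> = (\<integral>z. minR_score \<alpha> \<theta> z \<partial>model)"

definition residual :: "'a \<Rightarrow> real" where "residual \<omega> = U \<omega> / \<sigma>"

definition V :: "real ^ 'p ^ 'p" where "V = second_moment_matrix M X"

text \<open>The expectation of \<open>minR_phi'\<close> at a standard normal variable.\<close>
definition \<kappa> :: real where "\<kappa> = 1 / ((\<alpha> + 1) * sqrt (\<alpha> + 1))"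

lemma \<kappa>_pos: "\<kappa> > 0" using \<alpha>_pos by (simp add: \<kappa>_def)

lemma U_measurable [measurable]: "U \<in> borel_measurable M"
  using distributed_measurable[OF U_distr] by simp

lemma residual_measurable [measurable]: "residual \<in> borel_measurable M"
  unfolding residual_def[abs_def] by measurable

lemma pair_measurable [measurable]: "(\<lambda>\<omega>. (X \<omega>, \<beta> \<bullet> X \<omega> + U \<omega>)) \<in> M \<rightarrow>\<^sub>M borel"
  unfolding borel_prod[symmetric] by measurable

lemma prob_space_model: "prob_space model"
  unfolding model_def by (rule prob_space_distr) simp

lemma sets_model [simp]: "sets model = sets borel" and space_model [simp]: "space model = UNIV"
  by (simp_all add: model_def)

lemma minR_score_measurable: "snd \<theta> \<noteq> 0 \<Longrightarrow> minR_score \<alpha> \<theta> \<in> borel_measurable borel"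
  by (intro borel_measurable_continuous_onI continuous_on_minR_score) (auto intro: continuous_intros)

lemma X_norm_square_integrable: "integrable M (\<lambda>\<omega>. (norm (X \<omega>))\<^sup>2)"
  unfolding power2_norm_eq_inner inner_vec_def inner_real_def
  by (intro Bochner_Integration.integrable_sum X_square_integrable)

lemma X_norm_integrable: "integrable M (\<lambda>\<omega>. norm (X \<omega>))"
proof (rule Bochner_Integration.integrable_bound)
  show "integrable M (\<lambda>\<omega>. 1 + (norm (X \<omega>))\<^sup>2)" using X_norm_square_integrable by simp
  have "x \<le> 1 + x\<^sup>2" for x :: real
    using sum_power2_ge_zero[of x "x - 1"] by (simp add: power2_eq_square algebra_simps)
  then show "AE \<omega> in M. norm (norm (X \<omega>)) \<le> norm (1 + (norm (X \<omega>))\<^sup>2)" by (simp add: abs_of_nonneg)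
qed simp

lemma X_integrable: "integrable M X"
  using X_norm_integrable integrable_norm_cancel X_measurable by blast

lemma expectation_residual:
  assumes "g \<in> borel_measurable borel"
    and "has_bochner_integral lborel (\<lambda>u. normal_density 0 \<sigma> u * g (u / \<sigma>)) I"
  shows "has_bochner_integral M (\<lambda>\<omega>. g (residual \<omega>)) I"
proof -
  have m: "(\<lambda>u. g (u / \<sigma>)) \<in> borel_measurable lborel"
    using assms(1) by (intro measurable_compose[OF _ assms(1)]) simp
  show ?thesis
    using assms(2) distributed_integral[OF U_distr m] distributed_integrable[OF U_distr m]
    by (simp add: has_bochner_integral_iff residual_def)
qed

lemma expectation_residual_tilted:
  "has_bochner_integral M (\<lambda>\<omega>. residual \<omega> ^ (2 * k) * exp (- (\<alpha> / 2) * (residual \<omega>)\<^sup>2))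
    (fact (2 * k) / (2 ^ k * fact k) / ((\<alpha> + 1) ^ k * sqrt (\<alpha> + 1)))"
  by (rule expectation_residual[OF _ gaussian_tilted_moment[OF \<sigma>_pos \<alpha>_pos]]) simp

lemma expectation_residual_odd:
  fixes g :: "real \<Rightarrow> real"
  assumes "g \<in> borel_measurable borel" and "\<And>u. \<bar>g u\<bar> \<le> C" and "\<And>u. g (- u) = - g u"
  shows "has_bochner_integral M (\<lambda>\<omega>. g (residual \<omega>)) 0"
proof -
  have m: "(\<lambda>u. g (u / \<sigma>)) \<in> borel_measurable lborel"
    using assms(1) by (intro measurable_compose[OF _ assms(1)]) simp
  have "integrable M (\<lambda>\<omega>. g (residual \<omega>))"
    using assms(2) by (intro integrable_const_bound[of _ C] AE_I2 measurable_compose[OF residual_measurable assms(1)]) auto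
  moreover have "(\<integral>\<omega>. g (residual \<omega>) \<partial>M) = 0"
    using distributed_integral[OF U_distr m] gaussian_odd_integral_zero[of "\<lambda>u. g (u / \<sigma>)" \<sigma>] assms(3)
    by (simp add: residual_def)
  ultimately show ?thesis by (simp add: has_bochner_integral_iff)
qed

lemma residual_square_integrable: "integrable M (\<lambda>\<omega>. (residual \<omega>)\<^sup>2)"
proof -
  have "integrable M (\<lambda>\<omega>. (U \<omega>)\<^sup>2)"
    using distributed_integrable[OF U_distr, of "\<lambda>u. u\<^sup>2"] has_bochner_integral_integrable[of lborel]
      normal_moment_even[OF \<sigma>_pos, of 0 1] by (simp add: has_bochner_integral_iff)
  then show ?thesis by (simp add: residual_def power_divide)
qed

lemma minR_phi_measurable [measurable]: "minR_phi \<alpha> \<in> borel_measurable borel"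
  and minR_chi_measurable [measurable]: "minR_chi \<alpha> \<in> borel_measurable borel"
  and minR_phi'_measurable [measurable]: "minR_phi' \<alpha> \<in> borel_measurable borel"
  and minR_chi'_measurable [measurable]: "minR_chi' \<alpha> \<in> borel_measurable borel"
  unfolding minR_phi_def[abs_def] minR_chi_def[abs_def] minR_phi'_def[abs_def] minR_chi'_def[abs_def]
  by measurable

lemma expectation_minR_phi: "has_bochner_integral M (\<lambda>\<omega>. minR_phi \<alpha> (residual \<omega>)) 0"
proof -
  obtain C where "\<And>u. \<bar>minR_phi \<alpha> u\<bar> \<le> C" using minR_phi_bounded[OF \<alpha>_pos] by blast
  then show ?thesis by (rule expectation_residual_odd[rotated]) (auto simp: minR_phi_def)
qed

lemma expectation_minR_chi': "has_bochner_integral M (\<lambda>\<omega>. minR_chi' \<alpha> (residual \<omega>)) 0"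
proof -
  obtain C where "\<And>u. \<bar>minR_chi' \<alpha> u\<bar> \<le> C" using minR_chi'_bounded[OF \<alpha>_pos] by blast
  then show ?thesis by (rule expectation_residual_odd[rotated]) (auto simp: minR_chi'_def)
qed

lemma expectation_residual_minR_phi': "has_bochner_integral M (\<lambda>\<omega>. minR_phi' \<alpha> (residual \<omega>) * residual \<omega>) 0"
proof -
  have "\<exists>C. \<forall>u. \<bar>minR_phi' \<alpha> u * u\<bar> \<le> C"
  proof -
    obtain C where C: "\<And>u. \<bar>u ^ 1 * exp (- (\<alpha> / 2) * u\<^sup>2)\<bar> \<le> C"
      using gaussian_power_bounded[OF \<alpha>_pos, of 1] by metis
    obtain D where D: "\<And>u. \<bar>u ^ 3 * exp (- (\<alpha> / 2) * u\<^sup>2)\<bar> \<le> D"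
      using gaussian_power_bounded[OF \<alpha>_pos, of 3] by metis
    have "\<bar>minR_phi' \<alpha> u * u\<bar> \<le> C + \<alpha> * D" for u
    proof -
      have "minR_phi' \<alpha> u * u = u ^ 1 * exp (- (\<alpha> / 2) * u\<^sup>2) - \<alpha> * (u ^ 3 * exp (- (\<alpha> / 2) * u\<^sup>2))"
        by (simp add: minR_phi'_def algebra_simps power2_eq_square power3_eq_cube)
      also have "\<bar>\<dots>\<bar> \<le> \<bar>u ^ 1 * exp (- (\<alpha> / 2) * u\<^sup>2)\<bar> + \<alpha> * \<bar>u ^ 3 * exp (- (\<alpha> / 2) * u\<^sup>2)\<bar>"
        using \<alpha>_pos by (intro order_trans[OF abs_triangle_ineq4]) (simp add: abs_mult)
      also have "\<dots> \<le> C + \<alpha> * D" using \<alpha>_pos by (intro add_mono mult_left_mono C D) simp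
      finally show ?thesis .
    qed
    then show ?thesis by blast
  qed
  then obtain C where "\<And>u. \<bar>minR_phi' \<alpha> u * u\<bar> \<le> C" by blast
  then show ?thesis by (rule expectation_residual_odd[of "\<lambda>u. minR_phi' \<alpha> u * u", rotated]) (auto simp: minR_phi'_def)
qed

text \<open>
  The constant \<open>1 / (\<alpha> + 1)\<close> in \<open>minR_chi\<close> is the second moment of the tilted normal distribution
  relative to its mass, so it makes the scale equation hold at the model.
\<close>
lemma expectation_minR_chi: "has_bochner_integral M (\<lambda>\<omega>. minR_chi \<alpha> (residual \<omega>)) 0"
proof -
  have "minR_chi \<alpha> (residual \<omega>) = residual \<omega> ^ (2 * 1) * exp (- (\<alpha> / 2) * (residual \<omega>)\<^sup>2)
      - (1 / (\<alpha> + 1)) * (residual \<omega> ^ (2 * 0) * exp (- (\<alpha> / 2) * (residual \<omega>)\<^sup>2))" for \<omega>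
    by (simp add: minR_chi_def left_diff_distrib)
  then show ?thesis
    using has_bochner_integral_diff[OF expectation_residual_tilted[of 1]
        has_bochner_integral_mult_right[OF expectation_residual_tilted[of 0], of "1 / (\<alpha> + 1)"]] by simp
qed

lemma expectation_minR_phi': "has_bochner_integral M (\<lambda>\<omega>. minR_phi' \<alpha> (residual \<omega>)) \<kappa>"
proof -
  have "minR_phi' \<alpha> (residual \<omega>) = residual \<omega> ^ (2 * 0) * exp (- (\<alpha> / 2) * (residual \<omega>)\<^sup>2)
      - \<alpha> * (residual \<omega> ^ (2 * 1) * exp (- (\<alpha> / 2) * (residual \<omega>)\<^sup>2))" for \<omega>
    by (simp add: minR_phi'_def left_diff_distrib)
  moreover have "1 / q - \<alpha> * (1 / ((\<alpha> + 1) * q)) = 1 / ((\<alpha> + 1) * q)" if "q > 0" for q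
  proof -
    have "\<alpha> + 1 \<noteq> 0" "q \<noteq> 0" using \<alpha>_pos that by auto
    then show ?thesis by (simp add: divide_simps)
  qed
  from this[of "sqrt (\<alpha> + 1)"] have "1 / sqrt (\<alpha> + 1) - \<alpha> * (1 / ((\<alpha> + 1) * sqrt (\<alpha> + 1))) = \<kappa>"
    using \<alpha>_pos by (simp add: \<kappa>_def)
  ultimately show ?thesis
    using has_bochner_integral_diff[OF expectation_residual_tilted[of 0]
        has_bochner_integral_mult_right[OF expectation_residual_tilted[of 1], of \<alpha>]] by simp
qed

lemma expectation_residual_minR_chi':
  "has_bochner_integral M (\<lambda>\<omega>. minR_chi' \<alpha> (residual \<omega>) * residual \<omega>) (2 * \<kappa> / (\<alpha> + 1))"
proof -
  have "minR_chi' \<alpha> (residual \<omega>) * residual \<omega> = (2 + \<alpha> / (\<alpha> + 1)) * (residual \<omega> ^ (2 * 1) * exp (- (\<alpha> / 2) * (residual \<omega>)\<^sup>2))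
      - \<alpha> * (residual \<omega> ^ (2 * 2) * exp (- (\<alpha> / 2) * (residual \<omega>)\<^sup>2))" for \<omega>
    by (simp add: minR_chi'_def algebra_simps power2_eq_square power4_eq_xxxx)
  moreover have "(2 + \<alpha> / (\<alpha> + 1)) * (1 / ((\<alpha> + 1) * q)) - \<alpha> * (3 / ((\<alpha> + 1)\<^sup>2 * q))
      = 2 * (1 / ((\<alpha> + 1) * q)) / (\<alpha> + 1)" if "q > 0" for q
  proof -
    have "\<alpha> + 1 \<noteq> 0" "q \<noteq> 0" using \<alpha>_pos that by auto
    then show ?thesis by (simp add: divide_simps power2_eq_square)
  qed
  from this[of "sqrt (\<alpha> + 1)"]
  have "(2 + \<alpha> / (\<alpha> + 1)) * (fact (2 * 1) / (2 ^ 1 * fact 1) / ((\<alpha> + 1) ^ 1 * sqrt (\<alpha> + 1)))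
      - \<alpha> * (fact (2 * 2) / (2 ^ 2 * fact 2) / ((\<alpha> + 1) ^ 2 * sqrt (\<alpha> + 1))) = 2 * \<kappa> / (\<alpha> + 1)"
    using \<alpha>_pos by (simp add: \<kappa>_def fact_numeral)
  ultimately show ?thesis
    using has_bochner_integral_diff[OF has_bochner_integral_mult_right[OF expectation_residual_tilted[of 1], of "2 + \<alpha> / (\<alpha> + 1)"]
        has_bochner_integral_mult_right[OF expectation_residual_tilted[of 2], of \<alpha>]] by (simp only:)
qed

text \<open>
  The regressor and the error take values in different types, so their independence is expressed
  through the events they generate; real functions of them are independent random variables.
\<close>
lemma indep_var_compose_X_U:
  fixes f :: "real ^ 'p \<Rightarrow> real" and g :: "real \<Rightarrow> real"
  assumes f[measurable]: "f \<in> borel_measurable borel" and g[measurable]: "g \<in> borel_measurable borel"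
  shows "indep_var borel (\<lambda>\<omega>. f (X \<omega>)) borel (\<lambda>\<omega>. g (U \<omega>))"
proof -
  let ?G = "\<lambda>h::'a \<Rightarrow> real. {h -` A \<inter> space M | A. A \<in> sets borel}"
  have stable: "Int_stable (?G h)" for h
  proof (rule Int_stableI)
    fix a b assume "a \<in> ?G h" "b \<in> ?G h"
    then obtain A B where "a = h -` A \<inter> space M" "b = h -` B \<inter> space M" "A \<in> sets borel" "B \<in> sets borel"
      by blast
    then show "a \<inter> b \<in> ?G h" by (intro CollectI exI[of _ "A \<inter> B"]) auto
  qed
  have "?G (\<lambda>\<omega>. f (X \<omega>)) \<subseteq> {X -` A \<inter> space M | A. A \<in> sets borel}"
  proof
    fix a assume "a \<in> ?G (\<lambda>\<omega>. f (X \<omega>))"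
    then obtain A where "a = X -` (f -` A) \<inter> space M" "A \<in> sets borel" by (auto simp: vimage_def)
    then show "a \<in> {X -` A \<inter> space M | A. A \<in> sets borel}"
      using measurable_sets[OF f, of A] by auto
  qed
  moreover have "?G (\<lambda>\<omega>. g (U \<omega>)) \<subseteq> {U -` A \<inter> space M | A. A \<in> sets borel}"
  proof
    fix a assume "a \<in> ?G (\<lambda>\<omega>. g (U \<omega>))"
    then obtain A where "a = U -` (g -` A) \<inter> space M" "A \<in> sets borel" by (auto simp: vimage_def)
    then show "a \<in> {U -` A \<inter> space M | A. A \<in> sets borel}"
      using measurable_sets[OF g, of A] by auto
  qed
  ultimately have "indep_set (?G (\<lambda>\<omega>. f (X \<omega>))) (?G (\<lambda>\<omega>. g (U \<omega>)))"
    using indep unfolding indep_sets2_eq by (meson order_trans subsetD)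
  from indep_set_sigma_sets[OF this stable stable] show ?thesis
    unfolding indep_var_eq by simp
qed

lemma has_bochner_integral_residual_X:
  fixes f :: "real ^ 'p \<Rightarrow> 'e::euclidean_space"
  assumes g[measurable]: "g \<in> borel_measurable borel" and f[measurable]: "f \<in> borel_measurable borel"
    and gR: "has_bochner_integral M (\<lambda>\<omega>. g (residual \<omega>)) a" and fX: "has_bochner_integral M (\<lambda>\<omega>. f (X \<omega>)) v"
  shows "has_bochner_integral M (\<lambda>\<omega>. g (residual \<omega>) *\<^sub>R f (X \<omega>)) (a *\<^sub>R v)"
proof (rule has_bochner_integral_componentwise)
  fix b :: 'e assume b: "b \<in> Basis"
  have i: "indep_var borel (\<lambda>\<omega>. f (X \<omega>) \<bullet> b) borel (\<lambda>\<omega>. g (residual \<omega>))"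
    unfolding residual_def by (rule indep_var_compose_X_U[of "\<lambda>x. f x \<bullet> b" "\<lambda>u. g (u / \<sigma>)"]) auto
  have 1: "has_bochner_integral M (\<lambda>\<omega>. f (X \<omega>) \<bullet> b) (v \<bullet> b)"
    using fX by (intro has_bochner_integral_inner_left)
  from 1 gR have "has_bochner_integral M (\<lambda>\<omega>. (f (X \<omega>) \<bullet> b) * g (residual \<omega>)) ((v \<bullet> b) * a)"
    using indep_var_integrable[OF i] indep_var_lebesgue_integral[OF i] by (simp add: has_bochner_integral_iff)
  then show "has_bochner_integral M (\<lambda>\<omega>. (g (residual \<omega>) *\<^sub>R f (X \<omega>)) \<bullet> b) ((a *\<^sub>R v) \<bullet> b)"
    by (simp add: mult.commute)
qed

text \<open>
  The integrand is \<open>h\<close> under the outer product of \<open>X\<close> with itself, the mean of which is \<open>V\<close>.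
\<close>
lemma expectation_inner_X_X: "has_bochner_integral M (\<lambda>\<omega>. (h \<bullet> X \<omega>) *\<^sub>R X \<omega>) (V *v h)"
proof (rule has_bochner_integral_componentwise)
  fix b :: "real ^ 'p" assume "b \<in> Basis"
  then obtain i where b: "b = axis i 1" by (auto simp: Basis_vec_def)
  have "has_bochner_integral M (\<lambda>\<omega>. \<Sum>j\<in>UNIV. (X \<omega> $ i * X \<omega> $ j) * h $ j) (\<Sum>j\<in>UNIV. V $ i $ j * h $ j)"
    using X_square_integrable
    by (intro has_bochner_integral_sum has_bochner_integral_mult_left)
       (auto simp: has_bochner_integral_iff V_def second_moment_matrix_def)
  moreover have "(\<Sum>j\<in>UNIV. (X \<omega> $ i * X \<omega> $ j) * h $ j) = ((h \<bullet> X \<omega>) *\<^sub>R X \<omega>) \<bullet> b" for \<omega>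
  proof -
    have "((h \<bullet> X \<omega>) *\<^sub>R X \<omega>) \<bullet> b = (\<Sum>j\<in>UNIV. h $ j * X \<omega> $ j) * X \<omega> $ i"
      by (simp add: b inner_axis) (simp add: inner_vec_def)
    then show ?thesis by (simp add: sum_distrib_left ac_simps)
  qed
  ultimately show "has_bochner_integral M (\<lambda>\<omega>. ((h \<bullet> X \<omega>) *\<^sub>R X \<omega>) \<bullet> b) ((V *v h) \<bullet> b)"
    by (simp add: b inner_axis matrix_vector_mult_def)
qed

text \<open>
  The quadratic form is the expectation of \<open>(h \<bullet> X)\<^sup>2\<close>. If it vanished, \<open>X\<close> would lie almost surely
  in the hyperplane orthogonal to \<open>h\<close>.
\<close>
lemma V_pos:
  assumes "h \<noteq> 0"
  shows "h \<bullet> (V *v h) > 0"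
proof -
  have i: "has_bochner_integral M (\<lambda>\<omega>. (h \<bullet> X \<omega>)\<^sup>2) (h \<bullet> (V *v h))"
    using has_bochner_integral_inner_right[of h M, OF expectation_inner_X_X[of h]]
    by (simp add: power2_eq_square)
  then have eq: "(\<integral>\<omega>. (h \<bullet> X \<omega>)\<^sup>2 \<partial>M) = h \<bullet> (V *v h)" and int: "integrable M (\<lambda>\<omega>. (h \<bullet> X \<omega>)\<^sup>2)"
    by (simp_all add: has_bochner_integral_iff)
  have "h \<bullet> (V *v h) \<noteq> 0"
  proof
    assume "h \<bullet> (V *v h) = 0"
    then have "AE \<omega> in M. (h \<bullet> X \<omega>)\<^sup>2 = 0"
      using integral_nonneg_eq_0_iff_AE[OF int] eq by simp
    then have "prob {\<omega> \<in> space M. h \<bullet> X \<omega> = 0} = 1"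
      by (subst prob_Collect_eq_1) auto
    with nondegenerate[OF assms] show False by simp
  qed
  moreover have "h \<bullet> (V *v h) \<ge> 0" unfolding eq[symmetric] by simp
  ultimately show ?thesis by simp
qed

section \<open>The mean score near the model\<close>

text \<open>
  The derivative of the mean score at the model. It is block diagonal: the mixed terms contain the
  expectation of an odd function of the error. Hence it is inverted blockwise, and slope and scale
  have separate influence functions.
\<close>
definition score_deriv :: "(real ^ 'p) \<times> real \<Rightarrow> (real ^ 'p) \<times> real" where
  "score_deriv \<eta> = (- (\<kappa> / \<sigma>) *\<^sub>R (V *v fst \<eta>), - (2 * \<kappa> / ((\<alpha> + 1) * \<sigma>)) * snd \<eta>)"

definition score_deriv_inv :: "(real ^ 'p) \<times> real \<Rightarrow> (real ^ 'p) \<times> real" where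
  "score_deriv_inv w = (- (\<sigma> / \<kappa>) *\<^sub>R (matrix_inv V *v fst w), - ((\<alpha> + 1) * \<sigma> / (2 * \<kappa>)) * snd w)"

lemma linear_score_deriv_inv: "linear score_deriv_inv"
  by (rule linearI) (simp_all add: score_deriv_inv_def matrix_vector_right_distrib algebra_simps add_divide_distrib matrix_vector_mult_scaleR)

lemma inverse_deriv: "score_deriv_inv (score_deriv \<eta>) = \<eta>" and deriv_inverse: "score_deriv (score_deriv_inv w) = w"
  using \<kappa>_pos \<sigma>_pos \<alpha>_pos
  by (simp_all add: score_deriv_def score_deriv_inv_def matrix_vector_mul_assoc invertible_if_quadratic_form_pos[OF V_pos]
      linear_neg[OF matrix_vector_mul_linear] matrix_vector_mult_scaleR prod_eq_iff)

lemma scale_pos_near_model: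
  fixes \<theta> :: "(real ^ 'p) \<times> real"
  shows "\<theta> \<in> cball (\<beta>, \<sigma>) (\<sigma> / 2) \<Longrightarrow> snd \<theta> > 0"
  using dist_snd_le[of "(\<beta>, \<sigma>)" \<theta>] \<sigma>_pos by (simp add: dist_real_def)

lemma score_integrable:
  assumes "snd \<theta> > 0"
  shows "integrable model (minR_score \<alpha> \<theta>)"
proof -
  have [measurable]: "minR_score \<alpha> \<theta> \<in> borel_measurable borel" using assms by (simp add: minR_score_measurable)
  obtain C where C: "C \<ge> 0" "\<And>(\<theta> :: (real ^ 'p) \<times> real) z. norm (minR_score \<alpha> \<theta> z) \<le> C * (1 + norm (fst z))" using minR_score_bounded[OF \<alpha>_pos] by metis
  have "integrable M (\<lambda>\<omega>. minR_score \<alpha> \<theta> (X \<omega>, \<beta> \<bullet> X \<omega> + U \<omega>))"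
  proof (rule Bochner_Integration.integrable_bound)
    show "integrable M (\<lambda>\<omega>. C * (1 + norm (X \<omega>)))" using X_norm_integrable by simp
    show "AE \<omega> in M. norm (minR_score \<alpha> \<theta> (X \<omega>, \<beta> \<bullet> X \<omega> + U \<omega>)) \<le> norm (C * (1 + norm (X \<omega>)))"
      using C(2)[of \<theta>] C(1) by (auto simp: abs_of_nonneg)
  qed measurable
  then show ?thesis unfolding model_def by (subst integrable_distr_eq) auto
qed

lemma mean_score_eq: "snd \<theta> > 0 \<Longrightarrow> mean_score \<theta> = (\<integral>\<omega>. minR_score \<alpha> \<theta> (X \<omega>, \<beta> \<bullet> X \<omega> + U \<omega>) \<partial>M)"
  unfolding mean_score_def model_def using minR_score_measurable[of \<theta>] by (subst integral_distr) auto

lemma continuous_on_mean_score: "continuous_on {\<theta>. snd \<theta> > 0} mean_score"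
  unfolding continuous_on_sequentially comp_def
proof (intro allI ballI impI, elim conjE)
  fix s :: "nat \<Rightarrow> (real ^ 'p) \<times> real" and \<theta> assume \<theta>: "\<theta> \<in> {\<theta>. snd \<theta> > 0}" and s: "\<forall>n. s n \<in> {\<theta>. snd \<theta> > 0}" "s \<longlonglongrightarrow> \<theta>"
  obtain C where C: "\<And>\<theta> z :: (real ^ 'p) \<times> real. norm (minR_score \<alpha> \<theta> z) \<le> C * (1 + norm (fst z))" using minR_score_bounded[OF \<alpha>_pos] by metis
  show "(\<lambda>n. mean_score (s n)) \<longlonglongrightarrow> mean_score \<theta>"
    unfolding mean_score_def
  proof (rule integral_dominated_convergence)
    have "integrable M (\<lambda>\<omega>. C * (1 + norm (X \<omega>)))" using X_norm_integrable by simp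
    then show "integrable model (\<lambda>z. C * (1 + norm (fst z)))"
      unfolding model_def by (subst integrable_distr_eq) (auto intro!: borel_measurable_continuous_onI continuous_intros)
    show "AE z in model. norm (minR_score \<alpha> (s n) z) \<le> C * (1 + norm (fst z))" for n by (simp add: C)
    show "AE z in model. (\<lambda>n. minR_score \<alpha> (s n) z) \<longlonglongrightarrow> minR_score \<alpha> \<theta> z"
    proof (rule AE_I2)
      fix z :: "(real ^ 'p) \<times> real"
      have "continuous_on {\<theta>. snd \<theta> > 0} (\<lambda>\<theta>. minR_score \<alpha> \<theta> z)"
        by (rule continuous_on_minR_score) (auto intro: continuous_intros)
      then show "(\<lambda>n. minR_score \<alpha> (s n) z) \<longlonglongrightarrow> minR_score \<alpha> \<theta> z"
        using \<theta> s unfolding continuous_on_sequentially comp_def by blast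
    qed
  qed (use \<theta> s score_integrable in auto)
qed

lemma mean_score_model: "mean_score (\<beta>, \<sigma>) = 0"
proof -
  have "has_bochner_integral M (\<lambda>\<omega>. minR_phi \<alpha> (residual \<omega>) *\<^sub>R X \<omega>) (0 *\<^sub>R (\<integral>\<omega>. X \<omega> \<partial>M))"
    by (rule has_bochner_integral_residual_X[of _ "\<lambda>x. x"])
       (use expectation_minR_phi X_integrable in \<open>auto simp: has_bochner_integral_iff\<close>)
  from has_bochner_integral_Pair[OF this expectation_minR_chi]
  show ?thesis using \<sigma>_pos
    by (subst mean_score_eq) (auto simp: minR_score_def residual_def[symmetric] has_bochner_integral_iff zero_prod_def)
qed

text \<open>
  Differentiation under the integral sign gives the mean of the derivative of the score. By
  independence each term factors into an expectation over the error and one over the regressor.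
\<close>
lemma mean_score_has_derivative: "(mean_score has_derivative score_deriv) (at (\<beta>, \<sigma>))"
proof -
  let ?Z = "\<lambda>\<omega>. (X \<omega>, \<beta> \<bullet> X \<omega> + U \<omega>)"
  let ?f = "\<lambda>\<theta> \<omega>. minR_score \<alpha> \<theta> (?Z \<omega>)" and ?f' = "\<lambda>\<omega>. minR_score' \<alpha> (\<beta>, \<sigma>) (?Z \<omega>)"
  obtain L where L:
    "\<And>(\<theta> :: (real ^ 'p) \<times> real) z. \<theta> \<in> cball (\<beta>, \<sigma>) (\<sigma> / 2) \<Longrightarrow>
      norm (minR_score \<alpha> \<theta> z - minR_score \<alpha> (\<beta>, \<sigma>) z)
        \<le> L * ((1 + norm (fst z)) * (norm (fst z) + \<bar>(snd z - \<beta> \<bullet> fst z) / \<sigma>\<bar>)) * norm (\<theta> - (\<beta>, \<sigma>))"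
    "\<And>z \<eta>. norm (minR_score' \<alpha> (\<beta>, \<sigma>) z \<eta>)
        \<le> L * ((1 + norm (fst z)) * (norm (fst z) + \<bar>(snd z - \<beta> \<bullet> fst z) / \<sigma>\<bar>)) * norm \<eta>"
    using minR_score_lipschitz[OF \<alpha>_pos, of "(\<beta>, \<sigma>)"] \<sigma>_pos unfolding fst_conv snd_conv by metis
  define K where "K \<omega> = L * ((1 + norm (X \<omega>)) * (norm (X \<omega>) + \<bar>residual \<omega>\<bar>))" for \<omega>
  have f': "?f' \<omega> \<eta> = ((minR_phi' \<alpha> (residual \<omega>) * (- (fst \<eta> \<bullet> X \<omega> + snd \<eta> * residual \<omega>) / \<sigma>)) *\<^sub>R X \<omega>,
      minR_chi' \<alpha> (residual \<omega>) * (- (fst \<eta> \<bullet> X \<omega> + snd \<eta> * residual \<omega>) / \<sigma>))" for \<omega> \<eta>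
    by (simp add: minR_score'_def residual_def Let_def)
  have "((\<lambda>\<theta>. \<integral>\<omega>. ?f \<theta> \<omega> \<partial>M) has_derivative (\<lambda>\<eta>. \<integral>\<omega>. ?f' \<omega> \<eta> \<partial>M)) (at (\<beta>, \<sigma>))"
  proof (rule has_derivative_integral[of "\<sigma> / 2" _ _ _ _ K])
    show "integrable M (?f \<theta>)" if "\<theta> \<in> cball (\<beta>, \<sigma>) (\<sigma> / 2)" for \<theta>
      using score_integrable[OF scale_pos_near_model[OF that]] minR_score_measurable[of \<theta>] scale_pos_near_model[OF that]
      unfolding model_def by (subst (asm) integrable_distr_eq) auto
    show "((\<lambda>\<theta>. ?f \<theta> \<omega>) has_derivative ?f' \<omega>) (at (\<beta>, \<sigma>))" for \<omega>
      using \<sigma>_pos by (intro minR_score_has_derivative) simp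
    show "(\<lambda>\<omega>. ?f' \<omega> \<eta>) \<in> borel_measurable M" for \<eta>
      unfolding f' borel_prod[symmetric] by measurable
    have "integrable M (\<lambda>\<omega>. (1 + norm (X \<omega>)) * (norm (X \<omega>) + \<bar>residual \<omega>\<bar>))"
    proof (rule Bochner_Integration.integrable_bound)
      show "integrable M (\<lambda>\<omega>. 2 + 4 * (norm (X \<omega>))\<^sup>2 + 2 * (residual \<omega>)\<^sup>2)"
        using X_norm_square_integrable residual_square_integrable by simp
      \<comment> \<open>A product of two of the quantities 1, \<open>x\<close> and \<open>|r|\<close> is at most half the sum of their squares.\<close>
      have "\<bar>(1 + x) * (x + \<bar>r\<bar>)\<bar> \<le> \<bar>2 + 4 * x\<^sup>2 + 2 * r\<^sup>2\<bar>" if "x \<ge> 0" for x r :: real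
      proof -
        have "(1 + x) * (x + \<bar>r\<bar>) \<le> 2 + 4 * x\<^sup>2 + 2 * \<bar>r\<bar>\<^sup>2"
          using sum_power2_ge_zero[of "1 - x" "1 - \<bar>r\<bar>"] sum_power2_ge_zero[of "x - \<bar>r\<bar>" x]
          by (simp add: power2_eq_square algebra_simps)
             (use zero_le_square[of x] zero_le_square[of r] in linarith)
        then show ?thesis using that by (simp add: abs_of_nonneg)
      qed
      then show "AE \<omega> in M. norm ((1 + norm (X \<omega>)) * (norm (X \<omega>) + \<bar>residual \<omega>\<bar>))
          \<le> norm (2 + 4 * (norm (X \<omega>))\<^sup>2 + 2 * (residual \<omega>)\<^sup>2)" by simp
    qed measurable
    then show "integrable M K" unfolding K_def[abs_def] by simp
    show "norm (?f \<theta> \<omega> - ?f (\<beta>, \<sigma>) \<omega>) \<le> K \<omega> * norm (\<theta> - (\<beta>, \<sigma>))"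
      if "\<theta> \<in> cball (\<beta>, \<sigma>) (\<sigma> / 2)" for \<theta> \<omega>
      using L(1)[OF that, of "?Z \<omega>"] by (simp add: K_def residual_def)
    show "norm (?f' \<omega> \<eta>) \<le> K \<omega> * norm \<eta>" for \<eta> \<omega>
      using L(2)[of "?Z \<omega>" \<eta>] by (simp add: K_def residual_def)
  qed (use \<sigma>_pos in simp)
  moreover have "(\<integral>\<omega>. ?f' \<omega> \<eta> \<partial>M) = score_deriv \<eta>" for \<eta>
  proof -
    obtain h k where \<eta>: "\<eta> = (h, k)" by (cases \<eta>)
    have 1: "has_bochner_integral M (\<lambda>\<omega>. minR_phi' \<alpha> (residual \<omega>) *\<^sub>R ((h \<bullet> X \<omega>) *\<^sub>R X \<omega>)) (\<kappa> *\<^sub>R (V *v h))"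
      by (rule has_bochner_integral_residual_X[of _ "\<lambda>x. (h \<bullet> x) *\<^sub>R x", OF _ _ expectation_minR_phi' expectation_inner_X_X]) measurable
    have 2: "has_bochner_integral M (\<lambda>\<omega>. (minR_phi' \<alpha> (residual \<omega>) * residual \<omega>) *\<^sub>R X \<omega>) (0 *\<^sub>R (\<integral>\<omega>. X \<omega> \<partial>M))"
      by (rule has_bochner_integral_residual_X[of "\<lambda>u. minR_phi' \<alpha> u * u" "\<lambda>x. x"])
         (use expectation_residual_minR_phi' X_integrable in \<open>auto simp: has_bochner_integral_iff\<close>)
    have 3: "has_bochner_integral M (\<lambda>\<omega>. minR_chi' \<alpha> (residual \<omega>) *\<^sub>R (h \<bullet> X \<omega>)) (0 *\<^sub>R (\<integral>\<omega>. h \<bullet> X \<omega> \<partial>M))"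
      by (rule has_bochner_integral_residual_X[of _ "\<lambda>x. h \<bullet> x"])
         (use expectation_minR_chi' X_integrable in \<open>auto simp: has_bochner_integral_iff\<close>)
    have phi: "has_bochner_integral M (\<lambda>\<omega>. (- 1 / \<sigma>) *\<^sub>R (minR_phi' \<alpha> (residual \<omega>) *\<^sub>R ((h \<bullet> X \<omega>) *\<^sub>R X \<omega>))
        + (- k / \<sigma>) *\<^sub>R ((minR_phi' \<alpha> (residual \<omega>) * residual \<omega>) *\<^sub>R X \<omega>))
        ((- 1 / \<sigma>) *\<^sub>R (\<kappa> *\<^sub>R (V *v h)) + (- k / \<sigma>) *\<^sub>R (0 *\<^sub>R (\<integral>\<omega>. X \<omega> \<partial>M)))"
      by (intro has_bochner_integral_add has_bochner_integral_scaleR_right 1 2)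
    have chi: "has_bochner_integral M (\<lambda>\<omega>. (- 1 / \<sigma>) *\<^sub>R (minR_chi' \<alpha> (residual \<omega>) *\<^sub>R (h \<bullet> X \<omega>))
        + (- k / \<sigma>) *\<^sub>R (minR_chi' \<alpha> (residual \<omega>) * residual \<omega>))
        ((- 1 / \<sigma>) *\<^sub>R (0 *\<^sub>R (\<integral>\<omega>. h \<bullet> X \<omega> \<partial>M)) + (- k / \<sigma>) *\<^sub>R (2 * \<kappa> / (\<alpha> + 1)))"
      by (intro has_bochner_integral_add has_bochner_integral_scaleR_right 3 expectation_residual_minR_chi')
    have integrand: "((- 1 / \<sigma>) *\<^sub>R (minR_phi' \<alpha> (residual \<omega>) *\<^sub>R ((h \<bullet> X \<omega>) *\<^sub>R X \<omega>))
        + (- k / \<sigma>) *\<^sub>R ((minR_phi' \<alpha> (residual \<omega>) * residual \<omega>) *\<^sub>R X \<omega>),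
        (- 1 / \<sigma>) *\<^sub>R (minR_chi' \<alpha> (residual \<omega>) *\<^sub>R (h \<bullet> X \<omega>)) + (- k / \<sigma>) *\<^sub>R (minR_chi' \<alpha> (residual \<omega>) * residual \<omega>))
      = ?f' \<omega> \<eta>" for \<omega>
      unfolding f' \<eta> fst_conv snd_conv prod.inject scaleR_scaleR scaleR_left_distrib[symmetric] real_scaleR_def
      using \<sigma>_pos by (intro conjI arg_cong2[where f = scaleR] refl) (simp_all add: field_simps)
    have val: "((- 1 / \<sigma>) *\<^sub>R (\<kappa> *\<^sub>R (V *v h)) + (- k / \<sigma>) *\<^sub>R (0 *\<^sub>R (\<integral>\<omega>. X \<omega> \<partial>M)),
        (- 1 / \<sigma>) *\<^sub>R (0 *\<^sub>R (\<integral>\<omega>. h \<bullet> X \<omega> \<partial>M)) + (- k / \<sigma>) *\<^sub>R (2 * \<kappa> / (\<alpha> + 1))) = score_deriv \<eta>"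
      by (simp add: score_deriv_def \<eta> mult.commute)
    from has_bochner_integral_Pair[OF phi chi] show ?thesis
      unfolding integrand val by (simp add: has_bochner_integral_iff)
  qed
  ultimately have "((\<lambda>\<theta>. \<integral>\<omega>. ?f \<theta> \<omega> \<partial>M) has_derivative score_deriv) (at (\<beta>, \<sigma>))" by simp
  then show ?thesis
  proof (rule has_derivative_transform_within_open[of _ _ _ _ "ball (\<beta>, \<sigma>) (\<sigma> / 2)"])
    show "(\<integral>\<omega>. ?f \<theta> \<omega> \<partial>M) = mean_score \<theta>" if "\<theta> \<in> ball (\<beta>, \<sigma>) (\<sigma> / 2)" for \<theta>
      using that scale_pos_near_model[of \<theta>] ball_subset_cball by (subst mean_score_eq) auto
  qed (use \<sigma>_pos in auto)
qed

lemma continuous_on_mean_score_cball: "continuous_on (cball (\<beta>, \<sigma>) (\<sigma> / 2)) mean_score"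
  by (rule continuous_on_subset[OF continuous_on_mean_score]) (use scale_pos_near_model in blast)

lemma continuous_on_score_cball: "continuous_on (cball (\<beta>, \<sigma>) (\<sigma> / 2)) (\<lambda>\<theta>. minR_score \<alpha> \<theta> z)"
  by (rule continuous_on_minR_score) (use scale_pos_near_model in \<open>force intro: continuous_intros\<close>)+

section \<open>Solutions at contaminated measures\<close>

lemma solution_contaminated_iff:
  assumes "0 \<le> \<epsilon>" "\<epsilon> \<le> 1"
  shows "minR_solution \<alpha> (contaminated model z \<epsilon>) b s \<longleftrightarrow>
    s > 0 \<and> (1 - \<epsilon>) *\<^sub>R mean_score (b, s) + \<epsilon> *\<^sub>R minR_score \<alpha> (b, s) z = 0"
proof -
  have "has_bochner_integral (contaminated model z \<epsilon>) (minR_score \<alpha> (b, s)) 0 \<longleftrightarrow>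
      (1 - \<epsilon>) *\<^sub>R mean_score (b, s) + \<epsilon> *\<^sub>R minR_score \<alpha> (b, s) z = 0" if "s > 0"
    using has_bochner_integral_contaminated[OF prob_space_model _ assms score_integrable, of z "(b, s)"]
      has_bochner_integral_eq that unfolding mean_score_def by force
  then show ?thesis unfolding minR_solution_iff_score by blast
qed

lemma model_solution: "minR_solution \<alpha> model \<beta> \<sigma>"
  using mean_score_model score_integrable[of "(\<beta>, \<sigma>)"] \<sigma>_pos
  by (simp add: minR_solution_iff_score has_bochner_integral_iff mean_score_def)

text \<open>
  The second ball keeps the scale positive, as a solution requires, and within the range where the
  mean score is known to be continuous.
\<close>
lemma solution_near_model:
  assumes "r > 0"
  shows "\<forall>\<^sub>F \<epsilon> in at_right 0. 0 < \<epsilon> \<and> \<epsilon> < 1 \<and>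
    (\<exists>\<theta>\<in>cball (\<beta>, \<sigma>) r \<inter> cball (\<beta>, \<sigma>) (\<sigma> / 2). minR_solution \<alpha> (contaminated model z \<epsilon>) (fst \<theta>) (snd \<theta>))"
proof -
  have "\<forall>\<^sub>F \<epsilon> in at_right (0::real). 0 < \<epsilon> \<and> \<epsilon> < 1"
    unfolding eventually_at_right_field by (intro exI[of _ 1]) auto
  moreover have "\<forall>\<^sub>F \<epsilon> in at_right 0. \<exists>\<theta>\<in>cball (\<beta>, \<sigma>) r \<inter> cball (\<beta>, \<sigma>) (\<sigma> / 2).
      (1 - \<epsilon>) *\<^sub>R mean_score \<theta> + \<epsilon> *\<^sub>R minR_score \<alpha> \<theta> z = 0"
    using \<sigma>_pos by (intro perturbed_zero_exists_near[OF mean_score_model mean_score_has_derivative linear_score_deriv_inv inverse_deriv deriv_inverse]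
        continuous_on_mean_score_cball continuous_on_score_cball assms) simp
  ultimately show ?thesis
  proof eventually_elim
    case (elim \<epsilon>)
    then obtain \<theta> where \<theta>: "\<theta> \<in> cball (\<beta>, \<sigma>) r \<inter> cball (\<beta>, \<sigma>) (\<sigma> / 2)"
      "(1 - \<epsilon>) *\<^sub>R mean_score \<theta> + \<epsilon> *\<^sub>R minR_score \<alpha> \<theta> z = 0" by blast
    then have "minR_solution \<alpha> (contaminated model z \<epsilon>) (fst \<theta>) (snd \<theta>)"
      using elim scale_pos_near_model[of \<theta>] by (subst solution_contaminated_iff) auto
    then show ?case using elim \<theta>(1) by blast
  qed
qed

text \<open>
  Functionals that follow the branch issuing from the model have to choose among the solutions at a
  measure without knowing along which contamination the measure is approached. The distance to the
  model parameter is a criterion that depends on the measure only.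
\<close>
definition nearest_solution :: "((real ^ 'p) \<times> real) measure \<Rightarrow> (real ^ 'p) \<times> real \<Rightarrow> bool" where
  "nearest_solution Q \<theta> \<longleftrightarrow> minR_solution \<alpha> Q (fst \<theta>) (snd \<theta>) \<and>
     (\<forall>\<theta>'. minR_solution \<alpha> Q (fst \<theta>') (snd \<theta>') \<longrightarrow> dist (\<beta>, \<sigma>) \<theta> \<le> dist (\<beta>, \<sigma>) \<theta>')"

text \<open>
  The solutions within the ball form a compact set by continuity of the mean score, and those
  outside are farther away than any of them.
\<close>
lemma nearest_solution_exists:
  assumes \<epsilon>: "0 \<le> \<epsilon>" "\<epsilon> \<le> 1" and \<theta>: "\<theta> \<in> cball (\<beta>, \<sigma>) (\<sigma> / 2)"
    and sol: "minR_solution \<alpha> (contaminated model z \<epsilon>) (fst \<theta>) (snd \<theta>)"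
  shows "\<exists>\<theta>. nearest_solution (contaminated model z \<epsilon>) \<theta>"
proof -
  let ?D = "cball (\<beta>, \<sigma>) (\<sigma> / 2)"
  let ?H = "\<lambda>\<theta>. (1 - \<epsilon>) *\<^sub>R mean_score \<theta> + \<epsilon> *\<^sub>R minR_score \<alpha> \<theta> z"
  let ?S = "{\<theta> \<in> ?D. ?H \<theta> = 0}"
  have "continuous_on ?D ?H"
    by (intro continuous_intros continuous_on_mean_score_cball continuous_on_score_cball)
  then have "closed ?S" by (intro continuous_closed_preimage_constant) auto
  moreover have S: "\<theta> \<in> ?S" using sol \<theta> by (simp add: solution_contaminated_iff[OF \<epsilon>])
  ultimately obtain \<theta>1 where \<theta>1: "\<theta>1 \<in> ?S" "\<And>\<theta>'. \<theta>' \<in> ?S \<Longrightarrow> dist (\<beta>, \<sigma>) \<theta>1 \<le> dist (\<beta>, \<sigma>) \<theta>'"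
    using distance_attains_inf[of ?S "(\<beta>, \<sigma>)"] by blast
  have "nearest_solution (contaminated model z \<epsilon>) \<theta>1"
    unfolding nearest_solution_def
  proof (intro conjI allI impI)
    show "minR_solution \<alpha> (contaminated model z \<epsilon>) (fst \<theta>1) (snd \<theta>1)"
      using \<theta>1(1) scale_pos_near_model by (simp add: solution_contaminated_iff[OF \<epsilon>])
    fix \<theta>' assume s: "minR_solution \<alpha> (contaminated model z \<epsilon>) (fst \<theta>') (snd \<theta>')"
    show "dist (\<beta>, \<sigma>) \<theta>1 \<le> dist (\<beta>, \<sigma>) \<theta>'"
    proof (cases "\<theta>' \<in> ?D")
      case True
      then show ?thesis using s by (intro \<theta>1(2)) (simp add: solution_contaminated_iff[OF \<epsilon>])
    next
      case False
      then show ?thesis using \<theta>1(1) by simp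
    qed
  qed
  then show ?thesis ..
qed

text \<open>
  Choose a nearest solution where there is one, and any solution elsewhere. At the model this
  returns the model parameter, at distance 0; along a contamination it converges to it, because
  solutions exist arbitrarily close to the model parameter.
\<close>
lemma functionals_exist: "\<exists>T S. minR_functionals \<alpha> model \<beta> \<sigma> T S"
proof -
  define pick where "pick Q = (if \<exists>\<theta>. nearest_solution Q \<theta> then SOME \<theta>. nearest_solution Q \<theta>
    else SOME \<theta>. minR_solution \<alpha> Q (fst \<theta>) (snd \<theta>))" for Q
  have pick_nearest: "nearest_solution Q (pick Q)" if "\<exists>\<theta>. nearest_solution Q \<theta>" for Q
    using someI_ex[OF that] that by (simp add: pick_def)
  have pick_sol: "minR_solution \<alpha> Q (fst (pick Q)) (snd (pick Q))" if "\<exists>b s. minR_solution \<alpha> Q b s" for Q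
  proof (cases "\<exists>\<theta>. nearest_solution Q \<theta>")
    case True
    then show ?thesis using pick_nearest by (simp add: nearest_solution_def)
  next
    case False
    have "\<exists>\<theta>. minR_solution \<alpha> Q (fst \<theta>) (snd \<theta>)" using that by simp
    from someI_ex[OF this] False show ?thesis by (simp add: pick_def)
  qed
  have "nearest_solution model (\<beta>, \<sigma>)" by (simp add: nearest_solution_def model_solution)
  then have "nearest_solution model (pick model)" by (intro pick_nearest) blast
  then have "dist (\<beta>, \<sigma>) (pick model) \<le> dist (\<beta>, \<sigma>) (\<beta>, \<sigma>)"
    unfolding nearest_solution_def using model_solution by (metis fst_conv snd_conv)
  then have pick_P: "pick model = (\<beta>, \<sigma>)" by simp
  have lim: "((\<lambda>\<epsilon>. pick (contaminated model z \<epsilon>)) \<longlongrightarrow> (\<beta>, \<sigma>)) (at_right 0)" for z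
  proof (rule tendstoI)
    fix e :: real assume e: "e > 0"
    then have "e / 2 > 0" by simp
    from solution_near_model[OF this, of z]
    show "\<forall>\<^sub>F \<epsilon> in at_right 0. dist (pick (contaminated model z \<epsilon>)) (\<beta>, \<sigma>) < e"
    proof eventually_elim
      case (elim \<epsilon>)
      then obtain \<theta> where \<theta>: "\<theta> \<in> cball (\<beta>, \<sigma>) (e / 2)" "\<theta> \<in> cball (\<beta>, \<sigma>) (\<sigma> / 2)"
        "minR_solution \<alpha> (contaminated model z \<epsilon>) (fst \<theta>) (snd \<theta>)" by blast
      then have "nearest_solution (contaminated model z \<epsilon>) (pick (contaminated model z \<epsilon>))"
        using elim by (intro pick_nearest nearest_solution_exists[of \<epsilon> \<theta>]) auto
      then have "dist (\<beta>, \<sigma>) (pick (contaminated model z \<epsilon>)) \<le> dist (\<beta>, \<sigma>) \<theta>"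
        using \<theta>(3) unfolding nearest_solution_def by blast
      then show ?case using \<theta>(1) e by (simp add: dist_commute)
    qed
  qed
  have "minR_functionals \<alpha> model \<beta> \<sigma> (\<lambda>Q. fst (pick Q)) (\<lambda>Q. snd (pick Q))"
    unfolding minR_functionals_def
    using pick_sol pick_P model_solution tendsto_fst[OF lim] tendsto_snd[OF lim] by simp
  then show ?thesis by blast
qed

text \<open>
  For small \<open>\<epsilon>\<close> the contaminated measure admits a solution, so the functionals have to return one;
  they are assumed to converge to the model parameter, which makes them a family of perturbed zeros.
\<close>
lemma influence_functions:
  assumes TS: "minR_functionals \<alpha> model \<beta> \<sigma> T S"
  shows "has_influence_function T model z (fst (- score_deriv_inv (minR_score \<alpha> (\<beta>, \<sigma>) z)))"
    and "has_influence_function S model z (snd (- score_deriv_inv (minR_score \<alpha> (\<beta>, \<sigma>) z)))"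
proof -
  let ?Q = "contaminated model z"
  have TP: "T model = \<beta>" and SP: "S model = \<sigma>"
    using TS by (auto simp: minR_functionals_def)
  have T: "((\<lambda>\<epsilon>. T (?Q \<epsilon>)) \<longlongrightarrow> \<beta>) (at_right 0)" and S: "((\<lambda>\<epsilon>. S (?Q \<epsilon>)) \<longlongrightarrow> \<sigma>) (at_right 0)"
    and sol: "\<And>Q. prob_space Q \<Longrightarrow> sets Q = sets borel \<Longrightarrow> \<exists>b s. minR_solution \<alpha> Q b s
      \<Longrightarrow> minR_solution \<alpha> Q (T Q) (S Q)"
    using TS unfolding minR_functionals_def TP SP by blast+
  have "((\<lambda>\<epsilon>. ((T (?Q \<epsilon>), S (?Q \<epsilon>)) - (\<beta>, \<sigma>)) /\<^sub>R \<epsilon>) \<longlongrightarrow> - score_deriv_inv (minR_score \<alpha> (\<beta>, \<sigma>) z)) (at_right 0)"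
  proof (rule perturbed_zero_derivative[OF mean_score_model mean_score_has_derivative linear_score_deriv_inv inverse_deriv])
    show "isCont (\<lambda>\<theta>. minR_score \<alpha> \<theta> z) (\<beta>, \<sigma>)"
      by (rule continuous_on_interior[OF continuous_on_score_cball]) (use \<sigma>_pos in simp)
    show "((\<lambda>\<epsilon>. (T (?Q \<epsilon>), S (?Q \<epsilon>))) \<longlongrightarrow> (\<beta>, \<sigma>)) (at_right 0)"
      by (intro tendsto_Pair T S)
    from solution_near_model[OF zero_less_one, of z]
    show "\<forall>\<^sub>F \<epsilon> in at_right 0. (1 - \<epsilon>) *\<^sub>R mean_score (T (?Q \<epsilon>), S (?Q \<epsilon>))
        + \<epsilon> *\<^sub>R minR_score \<alpha> (T (?Q \<epsilon>), S (?Q \<epsilon>)) z = 0"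
    proof eventually_elim
      case (elim \<epsilon>)
      then have \<epsilon>: "0 \<le> \<epsilon>" "\<epsilon> \<le> 1" by auto
      have "minR_solution \<alpha> (?Q \<epsilon>) (T (?Q \<epsilon>)) (S (?Q \<epsilon>))"
        using elim by (intro sol prob_space_contaminated prob_space_model) auto
      then show ?case by (simp add: solution_contaminated_iff[OF \<epsilon>])
    qed
  qed
  from tendsto_fst[OF this] tendsto_snd[OF this]
  show "has_influence_function T model z (fst (- score_deriv_inv (minR_score \<alpha> (\<beta>, \<sigma>) z)))"
    and "has_influence_function S model z (snd (- score_deriv_inv (minR_score \<alpha> (\<beta>, \<sigma>) z)))"
    by (simp_all add: has_influence_function_def TP SP)
qed

end

section \<open>The influence functions\<close>

theorem theorem6:
  fixes M :: "'a measure"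
    and X :: "'a \<Rightarrow> real ^ 'p::finite"
    and U Y :: "'a \<Rightarrow> real"
    and \<beta> :: "real ^ 'p"
    and \<sigma> \<alpha> :: real
    and P\<^sub>\<xi> :: "((real ^ 'p) \<times> real) measure"
    and V\<^sub>X :: "real ^ 'p ^ 'p"
  assumes "\<alpha> > 0"
    and "\<sigma> > 0"
    and "prob_space M"
    and "X \<in> borel_measurable M"
    and "distributed M lborel U (normal_density 0 \<sigma>)"
    and "prob_space.indep_set M {X -` A \<inter> space M | A. A \<in> sets borel}
           {U -` B \<inter> space M | B. B \<in> sets borel}"
    and "\<And>a. a \<noteq> 0 \<Longrightarrow> measure M {\<omega> \<in> space M. a \<bullet> X \<omega> = 0} < 1"
    and "\<And>i j. integrable M (\<lambda>\<omega>. X \<omega> $ i * X \<omega> $ j)"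
    and "\<And>\<omega>. Y \<omega> = \<beta> \<bullet> X \<omega> + U \<omega>"
    and "P\<^sub>\<xi> = distr M borel (\<lambda>\<omega>. (X \<omega>, Y \<omega>))"
    and "V\<^sub>X = second_moment_matrix M X"
  shows "(\<exists>T S. minR_functionals \<alpha> P\<^sub>\<xi> \<beta> \<sigma> T S) \<and>
    (\<forall>T S. minR_functionals \<alpha> P\<^sub>\<xi> \<beta> \<sigma> T S \<longrightarrow>
      (\<forall>x\<^sub>0 y\<^sub>0.
        has_influence_function T P\<^sub>\<xi> (x\<^sub>0, y\<^sub>0)
          ((\<sigma> * (\<alpha> + 1) powr (3 / 2) * exp (- (\<alpha> / 2) * ((y\<^sub>0 - \<beta> \<bullet> x\<^sub>0) / \<sigma>)\<^sup>2)
             * ((y\<^sub>0 - \<beta> \<bullet> x\<^sub>0) / \<sigma>)) *\<^sub>R (matrix_inv V\<^sub>X *v x\<^sub>0)) \<and>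
        has_influence_function S P\<^sub>\<xi> (x\<^sub>0, y\<^sub>0)
          (\<sigma> * (\<alpha> + 1) powr (5 / 2) / 2 * exp (- (\<alpha> / 2) * ((y\<^sub>0 - \<beta> \<bullet> x\<^sub>0) / \<sigma>)\<^sup>2)
             * (((y\<^sub>0 - \<beta> \<bullet> x\<^sub>0) / \<sigma>)\<^sup>2 - 1 / (\<alpha> + 1)))))"
proof -
  interpret prob_space M by fact
  interpret gaussian_linear_model M X U \<beta> \<sigma> \<alpha>
    using assms by unfold_locales auto
  have model: "P\<^sub>\<xi> = model" using assms(9,10) by (simp add: model_def)
  have V: "V\<^sub>X = V" using assms(11) by (simp add: V_def)
  have powr: "(\<alpha> + 1) powr (3 / 2) = 1 / \<kappa>" "(\<alpha> + 1) powr (5 / 2) = (\<alpha> + 1) / \<kappa>"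
  proof -
    have "(\<alpha> + 1) powr (3 / 2) = (\<alpha> + 1) powr (1 + 1 / 2)" "(\<alpha> + 1) powr (5 / 2) = (\<alpha> + 1) powr (2 + 1 / 2)"
      by simp_all
    then show "(\<alpha> + 1) powr (3 / 2) = 1 / \<kappa>" "(\<alpha> + 1) powr (5 / 2) = (\<alpha> + 1) / \<kappa>"
      using \<alpha>_pos by (simp_all only: powr_add) (simp_all add: powr_half_sqrt \<kappa>_def power2_eq_square)
  qed
  have "fst (- score_deriv_inv (minR_score \<alpha> (\<beta>, \<sigma>) (x, y))) =
      (\<sigma> * (\<alpha> + 1) powr (3 / 2) * exp (- (\<alpha> / 2) * ((y - \<beta> \<bullet> x) / \<sigma>)\<^sup>2)
         * ((y - \<beta> \<bullet> x) / \<sigma>)) *\<^sub>R (matrix_inv V\<^sub>X *v x)" for x y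
    unfolding powr V
    by (simp add: score_deriv_inv_def minR_score_def minR_phi_def matrix_vector_mult_scaleR mult_ac)
  moreover have "snd (- score_deriv_inv (minR_score \<alpha> (\<beta>, \<sigma>) (x, y))) =
      \<sigma> * (\<alpha> + 1) powr (5 / 2) / 2 * exp (- (\<alpha> / 2) * ((y - \<beta> \<bullet> x) / \<sigma>)\<^sup>2)
         * (((y - \<beta> \<bullet> x) / \<sigma>)\<^sup>2 - 1 / (\<alpha> + 1))" for x y
    unfolding powr
    by (simp add: score_deriv_inv_def minR_score_def minR_chi_def mult_ac)
  ultimately show ?thesis
    unfolding model using functionals_exist influence_functions by metis
qed

end
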